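(* Let $X$ be a metrizable space and let $Y$ be a perfectly normal space. Let $D(X)$ be either $C(X)$ or $C^*(X)$, and, independently, let $D(Y)$ be either $C(Y)$ or $C^*(Y)$. Suppose that $T: D_p(X)\to D_p(Y)$ is a linear continuous surjection. Let $\mathcal P$ be any topological property of normal spaces satisfying the following conditions: (a) if $Z\in\mathcal P$ and $F\subset Z$ is closed, then $F\in\mathcal P$; (b) $\mathcal P$ is closed under finite products; (c) if $Z$ is a countable union of closed subsets each having the property $\mathcal P$, then $Z\in\mathcal P$; (d) if $f: Z\to W$ is a closed map with finite fibers, where $W$ is a metrizable space with $W\in\mathcal P$, then $Z\in\mathcal P$. If $X\in\mathcal P$, then $Y\in\mathcal P$.
   Context: All spaces are Tychonoff; maps between topological spaces in (d) are continuous. "$Z\in\mathcal P$" means that the space $Z$ has the property $\mathcal P$; $\mathcal P$ is a property of normal spaces. For a Tychonoff space $X$, $C(X)$ is the linear space of all continuous real-valued functions on $X$, and $C^*(X)\subset C(X)$ is the subspace of bounded functions. $D_p(X)$ denotes $D(X)$ endowed with the topology of pointwise convergence. The choices for $D(X)$ and $D(Y)$ are independent, so all four combinations are covered. *)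

theory Defs
  imports "HOL-Analysis.Analysis"
begin

text \<open>All spaces are Tychonoff. For normal spaces this amounts to adding the Hausdorff axiom.\<close>

definition T4_space :: "'a topology \<Rightarrow> bool" where
  "T4_space X \<longleftrightarrow> normal_space X \<and> Hausdorff_space X"

definition perfectly_normal_space :: "'a topology \<Rightarrow> bool" where
  "perfectly_normal_space X \<longleftrightarrow> T4_space X \<and> (\<forall>F. closedin X F \<longrightarrow> gdelta_in X F)"

text \<open>Real functions on \<^term>\<open>topspace X\<close> are represented by their extensional extensions to
  the whole type, so that equality of functions is equality on \<^term>\<open>topspace X\<close>.\<close>

definition cont_funs :: "'a topology \<Rightarrow> ('a \<Rightarrow> real) set" where
  "cont_funs X = {f \<in> extensional (topspace X). continuous_map X euclideanreal f}"

definition bdd_cont_funs :: "'a topology \<Rightarrow> ('a \<Rightarrow> real) set" where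
  "bdd_cont_funs X = {f \<in> cont_funs X. bounded (f ` topspace X)}"

definition pointwise_topology :: "'a topology \<Rightarrow> ('a \<Rightarrow> real) set \<Rightarrow> ('a \<Rightarrow> real) topology" where
  "pointwise_topology X D = subtopology (product_topology (\<lambda>x. euclideanreal) (topspace X)) D"

definition linear_on_funs ::
  "'a topology \<Rightarrow> ('a \<Rightarrow> real) set \<Rightarrow> 'b topology \<Rightarrow> (('a \<Rightarrow> real) \<Rightarrow> ('b \<Rightarrow> real)) \<Rightarrow> bool" where
  "linear_on_funs X D Y T \<longleftrightarrow>
     (\<forall>f\<in>D. \<forall>g\<in>D. T (\<lambda>x\<in>topspace X. f x + g x) = (\<lambda>y\<in>topspace Y. T f y + T g y)) \<and>
     (\<forall>c. \<forall>f\<in>D. T (\<lambda>x\<in>topspace X. c * f x) = (\<lambda>y\<in>topspace Y. c * T f y))"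

text \<open>A topological property of normal spaces is an isomorphism-closed class of normal spaces.
  HOL predicates cannot range over the topologies of all types, so the class consists of
  topologies with carrier in one arbitrary type \<^typ>\<open>'u\<close>; spaces that naturally live on another
  type (such as products) are referred to through their homeomorphic copies on \<^typ>\<open>'u\<close>.
  Since a carrier is any subset of its type, spaces on different types can always be moved to a
  common one.\<close>

definition topological_property :: "('u topology \<Rightarrow> bool) \<Rightarrow> bool" where
  "topological_property P \<longleftrightarrow>
     (\<forall>Z. P Z \<longrightarrow> T4_space Z) \<and>
     (\<forall>Z W. P Z \<and> Z homeomorphic_space W \<longrightarrow> P W)"

text \<open>The closure conditions below are conditions within the class of normal spaces: the space
  that is claimed to have the property is assumed normal where this is not automatic. Without
  this proviso \<open>closed_under_countable_closed_unions\<close> would fail for most properties, since a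
  countable union of closed normal subspaces need not be normal (e.g. the Niemytzki plane).\<close>

definition closed_hereditary :: "('u topology \<Rightarrow> bool) \<Rightarrow> bool" where
  "closed_hereditary P \<longleftrightarrow> (\<forall>Z F. P Z \<and> closedin Z F \<longrightarrow> P (subtopology Z F))"

definition closed_under_finite_products :: "('u topology \<Rightarrow> bool) \<Rightarrow> bool" where
  "closed_under_finite_products P \<longleftrightarrow>
     (\<forall>(I :: nat set) Z W. finite I \<and> I \<noteq> {} \<and> (\<forall>i\<in>I. P (Z i)) \<and>
        T4_space W \<and> W homeomorphic_space product_topology Z I \<longrightarrow> P W)"

definition closed_under_countable_closed_unions :: "('u topology \<Rightarrow> bool) \<Rightarrow> bool" where
  "closed_under_countable_closed_unions P \<longleftrightarrow>
     (\<forall>Z (F :: nat \<Rightarrow> 'u set). T4_space Z \<and>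
        (\<forall>n. closedin Z (F n) \<and> P (subtopology Z (F n))) \<and> topspace Z = (\<Union>n. F n) \<longrightarrow> P Z)"

definition finite_fibers :: "'a topology \<Rightarrow> 'b topology \<Rightarrow> ('a \<Rightarrow> 'b) \<Rightarrow> bool" where
  "finite_fibers Z W f \<longleftrightarrow> (\<forall>w\<in>topspace W. finite {z \<in> topspace Z. f z = w})"

definition closed_under_finite_to_one_closed_preimages :: "('u topology \<Rightarrow> bool) \<Rightarrow> bool" where
  "closed_under_finite_to_one_closed_preimages P \<longleftrightarrow>
     (\<forall>Z W (f :: 'u \<Rightarrow> 'u). T4_space Z \<and> metrizable_space W \<and> P W \<and>
        continuous_map Z W f \<and> closed_map Z W f \<and> finite_fibers Z W f \<longrightarrow> P Z)"

end

theory Submission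
  imports Defs
begin

text \<open>Each functional \<open>f \<mapsto> T f y\<close> is a combination of point evaluations over a finite set
  \<open>supp y \<subseteq> X\<close>, and \<open>supp\<close> is lower semicontinuous. Perfect normality makes
  \<open>{y. card (supp y) = n}\<close> an \<open>F\<^sub>\<sigma>\<close> set; cutting it further, by bounding the
  norms of the functionals, separating the points of \<open>supp y\<close>, and placing them in a set that is
  a discrete union of small closed pieces, one obtains countably many closed sets on which
  \<open>supp y\<close> can be enumerated continuously, giving a map into \<open>X\<^sup>n\<close>. Its fibers are finite since
  surjectivity of \<open>T\<close> makes the functionals linearly independent. It is a closed map: if the
  supports of \<open>y\<^sub>k\<close> converge, then, the coefficients being bounded, a subsequence of the functionals
  converges pointwise, so every bounded continuous function on \<open>Y\<close> converges along a subsequence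
  of \<open>y\<^sub>k\<close>, which by normality of \<open>Y\<close> must then have a cluster point. Copies of the powers of
  \<open>X\<close> on the type \<open>'u\<close> exist when \<open>'u\<close> is infinite; otherwise \<open>Y\<close> is finite.\<close>

section \<open>Linear relations and convergent subsequences\<close>

text \<open>Gaussian elimination for \<open>card K\<close> homogeneous equations in
  \<open>card F\<close> unknowns: each induction step removes one equation and at most one
  unknown.\<close>

lemma ex_nontrivial_linear_relation:
  fixes c :: "'b \<Rightarrow> 'a \<Rightarrow> real"
  assumes "finite K" "finite F" "card K < card F"
  shows "\<exists>a. (\<exists>y\<in>F. a y \<noteq> 0) \<and> (\<forall>x\<in>K. (\<Sum>y\<in>F. a y * c y x) = 0)"
  using assms
proof (induction K arbitrary: F c rule: finite_induct)
  case empty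
  then have "F \<noteq> {}" by auto
  then show ?case by (intro exI[of _ "\<lambda>_. 1"]) auto
next
  case (insert z K)
  show ?case
  proof (cases "\<forall>y\<in>F. c y z = 0")
    case True
    have "card K < card F" using insert by simp
    then obtain a where "\<exists>y\<in>F. a y \<noteq> 0" "\<forall>x\<in>K. (\<Sum>y\<in>F. a y * c y x) = 0"
      using insert.IH[OF insert.prems(1), of c] by blast
    then show ?thesis using True by (intro exI[of _ a]) auto
  next
    case False
    then obtain w where w: "w \<in> F" "c w z \<noteq> 0" by blast
    let ?F = "F - {w}"
    \<comment> \<open>Pivoting on \<open>w\<close>: subtracting multiples of row \<open>w\<close>
      clears coordinate \<open>z\<close>.\<close>
    let ?c = "\<lambda>y x. c y x - c y z / c w z * c w x"
    have "card K < card ?F" using insert w by simp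
    then obtain a where a: "\<exists>y\<in>?F. a y \<noteq> 0" "\<forall>x\<in>K. (\<Sum>y\<in>?F. a y * ?c y x) = 0"
      using insert.IH[of ?F ?c] insert.prems(1) by auto
    \<comment> \<open>With this weight on \<open>w\<close>, the combination of the rows
      \<open>c y\<close> equals that of the reduced rows \<open>?c y\<close>.\<close>
    define t where "t = - (\<Sum>y\<in>?F. a y * (c y z / c w z))"
    define b where "b = a(w := t)"
    have split: "(\<Sum>y\<in>F. b y * c y x) = t * c w x + (\<Sum>y\<in>?F. a y * c y x)" for x
    proof -
      have "(\<Sum>y\<in>F. b y * c y x) = b w * c w x + (\<Sum>y\<in>?F. b y * c y x)"
        using w insert.prems(1) by (simp add: sum.remove)
      also have "(\<Sum>y\<in>?F. b y * c y x) = (\<Sum>y\<in>?F. a y * c y x)"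
        by (rule sum.cong) (auto simp: b_def)
      finally show ?thesis by (simp add: b_def)
    qed
    have eq: "(\<Sum>y\<in>F. b y * c y x) = (\<Sum>y\<in>?F. a y * ?c y x)" for x
      unfolding split t_def
      by (simp add: right_diff_distrib sum_subtractf sum_distrib_right sum_distrib_left
          sum_negf mult.assoc)
    have "(\<Sum>y\<in>F. b y * c y x) = 0" if "x \<in> insert z K" for x
    proof (cases "x = z")
      case True
      then show ?thesis unfolding eq using w(2) by simp
    next
      case False
      then show ?thesis unfolding eq using that a(2) by simp
    qed
    moreover have "\<exists>y\<in>F. b y \<noteq> 0" using a(1) by (auto simp: b_def)
    ultimately show ?thesis by blast
  qed
qed

text \<open>Bolzano-Weierstrass for one sequence at a time, each time thinning the subsequence
  already found.\<close>

lemma finitely_many_bounded_imp_convergent_subseq: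
  fixes a :: "nat \<Rightarrow> nat \<Rightarrow> real"
  assumes "\<And>i. i < n \<Longrightarrow> bounded (range (a i))"
  shows "\<exists>r. strict_mono r \<and> (\<forall>i<n. convergent (\<lambda>k. a i (r k)))"
  using assms
proof (induction n)
  case 0
  then show ?case by (intro exI[of _ id]) (auto simp: strict_mono_def)
next
  case (Suc n)
  then obtain r where r: "strict_mono r" "\<And>i. i < n \<Longrightarrow> convergent (\<lambda>k. a i (r k))"
    by (auto simp: less_Suc_eq)
  have "bounded (range (a n \<circ> r))"
    by (rule bounded_subset[OF Suc.prems[of n]]) auto
  then obtain l s where s: "strict_mono s" "((a n \<circ> r) \<circ> s) \<longlonglongrightarrow> l"
    using bounded_imp_convergent_subsequence by blast
  have "convergent (\<lambda>k. a i (r (s k)))" if "i < n" for i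
    using convergent_subseq_convergent[OF r(2)[OF that] s(1)] by (simp add: o_def)
  moreover have "convergent (\<lambda>k. a n (r (s k)))"
    using s(2) by (auto simp: convergent_def o_def)
  ultimately show ?case
    using strict_mono_o[OF r(1) s(1)]
    by (intro exI[of _ "r \<circ> s"]) (auto simp: less_Suc_eq o_def)
qed

section \<open>Sequences in a normal space tested by bounded functions\<close>

lemma infinite_split:
  assumes "infinite A"
  obtains B where "B \<subseteq> A" "infinite B" "infinite (A - B)"
proof -
  obtain f :: "nat \<Rightarrow> 'a" where f: "inj f" "range f \<subseteq> A"
    using assms infinite_countable_subset by blast
  let ?E = "range (\<lambda>n. f (2 * n))" and ?O = "range (\<lambda>n. f (2 * n + 1))"
  have "infinite ?E" "infinite ?O"
    by (auto intro!: range_inj_infinite injI simp: inj_eq[OF f(1)])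
  have "?O \<subseteq> A - ?E"
    using f(2) by (auto simp: inj_eq[OF f(1)]) presburger
  then have "infinite (A - ?E)" using \<open>infinite ?O\<close> finite_subset by blast
  moreover have "?E \<subseteq> A" using f(2) by auto
  ultimately show thesis using that[of ?E] \<open>infinite ?E\<close> by blast
qed

lemma T4_space_bdd_Urysohn:
  assumes Y: "T4_space Y" and "closedin Y S" "closedin Y S'" "S \<inter> S' = {}"
  obtains g where "g \<in> bdd_cont_funs Y" "\<And>z. z \<in> S \<Longrightarrow> g z = 0" "\<And>z. z \<in> S' \<Longrightarrow> g z = 1"
proof -
  obtain f where f: "continuous_map Y (top_of_set {0..1::real}) f" "f ` S \<subseteq> {0}" "f ` S' \<subseteq> {1}"
    using Urysohn_lemma[of Y S S' 0 1] assms by (auto simp: T4_space_def disjnt_def)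
  define g where "g = restrict f (topspace Y)"
  have "continuous_map Y euclideanreal g"
    using f(1) by (auto simp: g_def continuous_map_in_subtopology elim: continuous_map_eq)
  moreover have "bounded (g ` topspace Y)"
    using f(1) by (intro bounded_subset[OF bounded_closed_interval[of 0 1]])
      (auto simp: g_def continuous_map_in_subtopology)
  ultimately have "g \<in> bdd_cont_funs Y"
    by (auto simp: bdd_cont_funs_def cont_funs_def g_def)
  moreover have "g z = f z" if "z \<in> S \<union> S'" for z
    using that closedin_subset[OF assms(2)] closedin_subset[OF assms(3)] by (auto simp: g_def)
  ultimately show thesis using f(2,3) by (intro that[of g]) auto
qed

text \<open>Urysohn's lemma applied to two infinite halves of the range: a sequence along which all
  bounded functions converge cannot be closed and discrete.\<close>

lemma convergent_test_functions_imp_cluster_point: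
  fixes y :: "nat \<Rightarrow> 'b"
  assumes Y: "T4_space Y" and y: "range y \<subseteq> topspace Y"
    and conv: "\<And>g. g \<in> bdd_cont_funs Y \<Longrightarrow> convergent (\<lambda>k. g (y k))"
  shows "\<exists>z\<in>topspace Y. \<forall>V. openin Y V \<and> z \<in> V \<longrightarrow> infinite {k. y k \<in> V}"
proof (rule ccontr)
  assume contra: "\<not> ?thesis"
  then have nc: "\<exists>V. openin Y V \<and> z \<in> V \<and> finite {k. y k \<in> V}" if "z \<in> topspace Y" for z
    using that contra by blast
  \<comment> \<open>Without a cluster point the singletons of \<open>range y\<close> form a locally
    finite family, so every set of values is closed.\<close>
  have closed: "closedin Y B" if "B \<subseteq> range y" for B
  proof -
    have "locally_finite_in Y ((\<lambda>x. {x}) ` B)"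
      unfolding locally_finite_in_def
    proof (intro conjI ballI)
      show "\<Union> ((\<lambda>x. {x}) ` B) \<subseteq> topspace Y" using that y by auto
    next
      fix z assume "z \<in> topspace Y"
      then obtain V where V: "openin Y V" "z \<in> V" "finite {k. y k \<in> V}" using nc by blast
      have "{U \<in> (\<lambda>x. {x}) ` B. U \<inter> V \<noteq> {}} \<subseteq> (\<lambda>k. {y k}) ` {k. y k \<in> V}"
        using that by auto
      then show "\<exists>V. openin Y V \<and> z \<in> V \<and> finite {U \<in> (\<lambda>x. {x}) ` B. U \<inter> V \<noteq> {}}"
        using V by (meson finite_imageI finite_subset)
    qed
    moreover have "closedin Y S" if "S \<in> (\<lambda>x. {x}) ` B" for S
      using that \<open>B \<subseteq> range y\<close> Y y by (auto simp: T4_space_def intro!: closedin_Hausdorff_singleton)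
    ultimately have "closedin Y (\<Union> ((\<lambda>x. {x}) ` B))" by (rule closedin_locally_finite_Union[rotated])
    then show ?thesis by simp
  qed
  \<comment> \<open>Finite multiplicities make the range infinite, so that it can be split in
    two.\<close>
  have fin: "finite {k. y k = z}" for z
  proof (cases "z \<in> topspace Y")
    case True
    then obtain V where "z \<in> V" "finite {k. y k \<in> V}" using nc by blast
    then show ?thesis by (auto elim: finite_subset[rotated])
  next
    case False
    then have "{k. y k = z} = {}" using y by auto
    then show ?thesis by simp
  qed
  have inf: "infinite (range y)"
  proof
    assume "finite (range y)"
    then have "finite (\<Union>z\<in>range y. {k. y k = z})" using fin by blast
    moreover have "(\<Union>z\<in>range y. {k. y k = z}) = UNIV" by auto
    ultimately show False by simp
  qed
  obtain B where B: "B \<subseteq> range y" "infinite B" "infinite (range y - B)"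
    using infinite_split[OF inf] .
  obtain g where g: "g \<in> bdd_cont_funs Y" "\<And>z. z \<in> B \<Longrightarrow> g z = 0"
      "\<And>z. z \<in> range y - B \<Longrightarrow> g z = 1"
    using T4_space_bdd_Urysohn[OF Y closed[of B] closed[of "range y - B"]] B by auto
  obtain l where l: "(\<lambda>k. g (y k)) \<longlonglongrightarrow> l" using conv g(1) convergent_def by blast
  have "l = 0 \<and> l = 1"
  proof -
    have *: "\<exists>\<^sub>F k in sequentially. y k \<in> C" if "infinite C" "C \<subseteq> range y" for C
    proof -
      have "infinite {k. y k \<in> C}"
      proof
        assume "finite {k. y k \<in> C}"
        then have "finite (y ` {k. y k \<in> C})" by (rule finite_imageI)
        moreover have "C \<subseteq> y ` {k. y k \<in> C}" using that(2) by auto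
        ultimately show False using that(1) finite_subset by blast
      qed
      then show ?thesis
        by (simp add: frequently_cofinite cofinite_eq_sequentially[symmetric])
    qed
    \<comment> \<open>A limit must equal any value taken at infinitely many indices; both
      \<open>0\<close> and \<open>1\<close> are such values.\<close>
    have **: "l = v" if "\<exists>\<^sub>F k in sequentially. g (y k) = v" for v
    proof (rule ccontr)
      assume "l \<noteq> v"
      then have "\<forall>\<^sub>F k in sequentially. g (y k) \<noteq> v"
        using l tendsto_imp_eventually_ne by blast
      then show False using that by (simp add: frequently_def)
    qed
    have "g (y k) = 0" if "y k \<in> B" for k
      using that by (rule g(2))
    then have "l = 0" using *[OF B(2,1)] by (intro **) (auto elim!: frequently_elim1)
    moreover have "g (y k) = 1" if "y k \<in> range y - B" for k
      using that by (rule g(3))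
    then have "l = 1" using *[OF B(3)] by (intro **) (auto elim!: frequently_elim1)
    ultimately show ?thesis by simp
  qed
  then show False by auto
qed

section \<open>Bump functions and locally constant labels in metric spaces\<close>

context Metric_space
begin

text \<open>A tent of height \<open>1\<close> at \<open>x\<close> that vanishes at distance
  \<open>r\<close> and beyond; the restriction to \<open>M\<close> makes it extensional, as
  membership in \<open>bdd_cont_funs\<close> demands.\<close>

definition bump :: "'a \<Rightarrow> real \<Rightarrow> 'a \<Rightarrow> real" where
  "bump x r = (\<lambda>z\<in>M. max 0 (1 - d x z / r))"

lemma continuous_map_dist_from:
  assumes "x \<in> M"
  shows "continuous_map mtopology euclideanreal (d x)"
  unfolding continuous_map_from_metric
proof (intro conjI ballI allI impI)
  fix a U assume "a \<in> M" and U: "openin euclideanreal U \<and> d x a \<in> U"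
  then obtain e where e: "e > 0" "\<And>t. dist t (d x a) < e \<Longrightarrow> t \<in> U"
    by (auto simp: open_dist)
  have "d x z \<in> U" if "z \<in> M" "d a z < e" for z
    using triangle[of x a z] triangle[of x z a] that \<open>a \<in> M\<close> assms
    by (intro e(2)) (auto simp: dist_real_def commute abs_if)
  then show "\<exists>r>0. \<forall>z. z \<in> M \<and> d a z < r \<longrightarrow> d x z \<in> U" using e(1) by blast
qed auto

lemma bump_in_bdd_cont_funs:
  assumes "x \<in> M" "r > 0"
  shows "bump x r \<in> bdd_cont_funs mtopology"
proof -
  have "continuous_map mtopology euclideanreal (\<lambda>z. max 0 (1 - d x z * (1 / r)))"
    by (intro continuous_intros continuous_map_dist_from assms)
  then have "continuous_map mtopology euclideanreal (bump x r)"
    by (rule continuous_map_eq) (auto simp: bump_def)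
  moreover have "bump x r ` M \<subseteq> {0..1}"
    using assms by (auto simp: bump_def)
  then have "bounded (bump x r ` M)"
    using bounded_closed_interval bounded_subset by blast
  ultimately show ?thesis
    by (auto simp: bdd_cont_funs_def cont_funs_def bump_def)
qed

lemma bump_range: "r > 0 \<Longrightarrow> z \<in> M \<Longrightarrow> bump x r z \<in> {0..1}"
  by (auto simp: bump_def)

lemma bump_centre: "x \<in> M \<Longrightarrow> bump x r x = 1"
  by (auto simp: bump_def)

lemma bump_eq_0: "r > 0 \<Longrightarrow> z \<in> M \<Longrightarrow> r \<le> d x z \<Longrightarrow> bump x r z = 0"
  by (auto simp: bump_def max_def field_simps)

lemma finite_isolating_radius:
  assumes "finite K" "K \<subseteq> M" "x \<in> M"
  obtains r where "r > 0" "\<And>z. z \<in> K \<Longrightarrow> z \<noteq> x \<Longrightarrow> r \<le> d x z"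
proof -
  \<comment> \<open>The \<open>1\<close> keeps the minimum defined when \<open>K\<close> has no
    point other than \<open>x\<close>.\<close>
  define r where "r = Min (insert 1 (d x ` (K - {x})))"
  have "r > 0" using assms by (auto simp: r_def)
  moreover have "r \<le> d x z" if "z \<in> K" "z \<noteq> x" for z
    using assms that by (auto simp: r_def)
  ultimately show thesis using that by blast
qed

lemma finite_separated:
  assumes "finite K" "K \<subseteq> M"
  obtains r where "r > 0" "\<And>x z. x \<in> K \<Longrightarrow> z \<in> K \<Longrightarrow> z \<noteq> x \<Longrightarrow> r \<le> d x z"
proof -
  define r where "r = Min (insert 1 ((\<lambda>(x,z). d x z) ` {p \<in> K \<times> K. fst p \<noteq> snd p}))"
  have fin: "finite {p \<in> K \<times> K. fst p \<noteq> snd p}" using assms by simp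
  have "r > 0" using assms fin by (auto simp: r_def subset_iff)
  moreover have "r \<le> d x z" if "x \<in> K" "z \<in> K" "z \<noteq> x" for x z
    unfolding r_def using that fin by (intro Min_le) (auto intro!: image_eqI[of _ _ "(x,z)"])
  ultimately show thesis using that by blast
qed

text \<open>Stone's argument for paracompactness: \<open>p x\<close> is the first point, in some well-order, whose
  \<open>r\<close>-ball contains \<open>x\<close>. Points that lie \<open>1/(j+1)\<close>-deep in their first ball have
  the same first ball as soon as they are \<open>1/(j+1)\<close>-close.\<close>

lemma locally_constant_small_partition:
  assumes "e > 0"
  obtains p :: "'a \<Rightarrow> 'a" and X where
    "\<And>j. closedin mtopology (X j)" "M = (\<Union>j. X j)" "incseq X"
    "\<And>j x z. x \<in> X j \<Longrightarrow> z \<in> X j \<Longrightarrow> d x z < 1 / Suc j \<Longrightarrow> p x = p z"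
    "\<And>x z. x \<in> M \<Longrightarrow> z \<in> M \<Longrightarrow> p x = p z \<Longrightarrow> d x z < e"
proof -
  \<comment> \<open>Half of \<open>e\<close>: two points with the same first ball are each within
    \<open>r\<close> of its centre.\<close>
  define r where "r = e / 2"
  have r: "r > 0" using assms by (simp add: r_def)
  obtain R :: "('a \<times> 'a) set" where R: "well_order_on UNIV R" using well_order_on by blast
  have wf: "wf (R - Id)" using R by (simp add: well_order_on_def)
  have tot: "(a, b) \<in> R - Id \<or> (b, a) \<in> R - Id" if "a \<noteq> b" for a b
    using R that by (auto simp: well_order_on_def linear_order_on_def total_on_def)
  have "\<exists>q. q \<in> M \<and> d x q < r \<and> (\<forall>q'. (q', q) \<in> R - Id \<longrightarrow> q' \<in> M \<longrightarrow> r \<le> d x q')"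
    if "x \<in> M" for x
  proof -
    have "x \<in> {q \<in> M. d x q < r}" using that r by simp
    from wfE_min[OF wf this] show ?thesis by (metis (mono_tags, lifting) mem_Collect_eq not_less)
  qed
  then obtain p where p: "\<And>x. x \<in> M \<Longrightarrow> p x \<in> M" "\<And>x. x \<in> M \<Longrightarrow> d x (p x) < r"
      "\<And>x q. x \<in> M \<Longrightarrow> (q, p x) \<in> R - Id \<Longrightarrow> q \<in> M \<Longrightarrow> r \<le> d x q"
    by metis
  define X where "X j = {x \<in> M. d x (p x) \<le> r - 1 / Suc j}" for j :: nat
  \<comment> \<open>Only \<open>x\<close> has to lie deep in its ball: the room
    \<open>1 / Suc j\<close> puts \<open>z\<close> into the ball around \<open>p x\<close>, which
    therefore cannot strictly precede \<open>p z\<close>.\<close>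
  have close: "p x = p z" if "x \<in> X j" "z \<in> M" "d x z < 1 / Suc j" "(p z, p x) \<notin> R - Id" for x z j
  proof (rule ccontr)
    assume "p x \<noteq> p z"
    then have "(p x, p z) \<in> R - Id" using tot that by metis
    then have "r \<le> d z (p x)" using p that by (auto simp: X_def)
    also have "\<dots> \<le> d z x + d x (p x)" using that p by (intro triangle) (auto simp: X_def)
    also have "\<dots> < r" using that by (auto simp: X_def commute)
    finally show False by simp
  qed
  have eq: "p x = p z" if "x \<in> X j" "z \<in> X j" "d x z < 1 / Suc j" for x z j
  proof (cases "(p z, p x) \<in> R - Id")
    case True
    then have "(p x, p z) \<notin> R - Id" using wf by (meson wf_asym)
    then show ?thesis using close[of z j x] that by (auto simp: X_def commute)
  next
    case False
    then show ?thesis using close that by (auto simp: X_def)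
  qed
  show thesis
  proof
    fix j
    show "closedin mtopology (X j)"
      unfolding metric_closedin_iff_sequentially_closed
    proof (intro conjI allI impI)
      show "X j \<subseteq> M" by (auto simp: X_def)
    next
      fix \<sigma> l assume *: "range \<sigma> \<subseteq> X j \<and> limitin mtopology \<sigma> l sequentially"
      then have l: "l \<in> M" and \<sigma>: "\<And>n. \<sigma> n \<in> X j" "\<And>n. \<sigma> n \<in> M"
        by (auto simp: limitin_mspace X_def)
      have ev: "\<exists>N. \<forall>n\<ge>N. d (\<sigma> n) l < h" if "h > 0" for h
        using * that unfolding limit_metric_sequentially by meson
      \<comment> \<open>Half of \<open>1 / Suc j\<close>, so that late terms of the sequence are
        close enough to share one label \<open>q\<close>.\<close>
      define h where "h = 1 / (2 * real (Suc j))"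
      obtain N where N: "\<And>n. n \<ge> N \<Longrightarrow> d (\<sigma> n) l < h" using ev[of h] by (auto simp: h_def)
      define q where "q = p (\<sigma> N)"
      have q: "q \<in> M" using p \<sigma> by (simp add: q_def)
      have pq: "p (\<sigma> n) = q" if "n \<ge> N" for n
      proof -
        have "d (\<sigma> n) (\<sigma> N) \<le> d (\<sigma> n) l + d (\<sigma> N) l"
          using triangle[of "\<sigma> n" l "\<sigma> N"] l \<sigma> by (simp add: commute)
        also have "\<dots> < 2 * h" using N[of n] N[of N] that by simp
        also have "2 * h = 1 / Suc j" by (simp add: h_def field_simps)
        finally show ?thesis using eq[of "\<sigma> n" j "\<sigma> N"] \<sigma> by (simp add: q_def)
      qed
      have le: "d l q \<le> r - 1 / Suc j"
      proof (rule field_le_epsilon)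
        fix h :: real assume "h > 0"
        then obtain N' where N': "\<And>n. n \<ge> N' \<Longrightarrow> d (\<sigma> n) l < h" using ev by blast
        let ?n = "max N N'"
        have "d l q \<le> d l (\<sigma> ?n) + d (\<sigma> ?n) q" using l \<sigma> q by (intro triangle)
        moreover have "d (\<sigma> ?n) q \<le> r - 1 / Suc j" using \<sigma>(1)[of ?n] pq[of ?n] by (simp add: X_def)
        ultimately show "d l q \<le> r - 1 / Suc j + h" using N'[of ?n] by (simp add: commute)
      qed
      \<comment> \<open>Lying outside an open ball is preserved by limits, so no point before
        \<open>q\<close> serves \<open>l\<close>; by \<open>le\<close>, the point \<open>q\<close>
        does.\<close>
      have min: "r \<le> d l q'" if "(q', q) \<in> R - Id" "q' \<in> M" for q'
      proof (rule field_le_epsilon)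
        fix h :: real assume "h > 0"
        then obtain N' where N': "\<And>n. n \<ge> N' \<Longrightarrow> d (\<sigma> n) l < h" using ev by blast
        let ?n = "max N N'"
        have "r \<le> d (\<sigma> ?n) q'" using p(3)[of "\<sigma> ?n" q'] pq[of ?n] that \<sigma> by simp
        also have "\<dots> \<le> d (\<sigma> ?n) l + d l q'" using l \<sigma> that by (intro triangle)
        finally show "r \<le> d l q' + h" using N'[of ?n] by simp
      qed
      have "p l = q"
      proof (rule ccontr)
        assume "p l \<noteq> q"
        then consider "(p l, q) \<in> R - Id" | "(q, p l) \<in> R - Id" using tot by metis
        then show False
        proof cases
          case 1
          then show False using min[of "p l"] p[of l] l by simp
        next
          case 2
          have "(0::real) < 1 / Suc j" by simp
          then show False using p(3)[of l q] 2 l q le by linarith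
        qed
      qed
      then show "l \<in> X j" using l le by (simp add: X_def)
    qed
  next
    have "\<exists>j. x \<in> X j" if "x \<in> M" for x
    proof -
      have "r - d x (p x) > 0" using p that by simp
      then obtain j where "inverse (real (Suc j)) < r - d x (p x)" using reals_Archimedean by blast
      then have "x \<in> X j" using that by (simp add: X_def inverse_eq_divide)
      then show ?thesis by blast
    qed
    then show "M = (\<Union>j. X j)" by (auto simp: X_def)
  next
    show "incseq X"
    proof (rule monoI)
      fix i j :: nat assume "i \<le> j"
      then have "1 / Suc j \<le> 1 / Suc i" by (simp add: frac_le)
      then show "X i \<subseteq> X j" by (auto simp: X_def)
    qed
  next
    fix j x z assume "x \<in> X j" "z \<in> X j" "d x z < 1 / Suc j"
    then show "p x = p z" by (rule eq)
  next
    fix x z assume xz: "x \<in> M" "z \<in> M" "p x = p z"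
    then have "d x z \<le> d x (p x) + d z (p z)" using triangle[of x "p x" z] p by (simp add: commute)
    also have "\<dots> < e" using p(2)[of x] p(2)[of z] xz by (simp add: r_def)
    finally show "d x z < e" .
  qed
qed

end

section \<open>Pointwise continuous functionals as finite sums of evaluations\<close>

text \<open>Treats \<open>cont_funs\<close> and \<open>bdd_cont_funs\<close> at once; sums and
  multiples are restricted to \<open>A\<close> again so that they stay extensional.\<close>

definition linear_function_space :: "'a set \<Rightarrow> ('a \<Rightarrow> real) set \<Rightarrow> bool" where
  "linear_function_space A D \<longleftrightarrow> D \<subseteq> extensional A \<and>
     (\<forall>f\<in>D. \<forall>g\<in>D. (\<lambda>x\<in>A. f x + g x) \<in> D) \<and> (\<forall>a. \<forall>f\<in>D. (\<lambda>x\<in>A. a * f x) \<in> D)"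

lemma linear_function_space_cont_funs: "linear_function_space (topspace X) (cont_funs X)"
proof -
  have "continuous_map X euclideanreal (\<lambda>x\<in>topspace X. f x + g x)"
    if fg: "continuous_map X euclideanreal f" "continuous_map X euclideanreal g" for f g
  proof -
    have "continuous_map X euclideanreal (\<lambda>x. f x + g x)" using fg by (intro continuous_intros)
    then show ?thesis by (rule continuous_map_eq) auto
  qed
  moreover have "continuous_map X euclideanreal (\<lambda>x\<in>topspace X. a * f x)"
    if f: "continuous_map X euclideanreal f" for a f
  proof -
    have "continuous_map X euclideanreal (\<lambda>x. a * f x)" using f by (intro continuous_intros)
    then show ?thesis by (rule continuous_map_eq) auto
  qed
  ultimately show ?thesis by (auto simp: linear_function_space_def cont_funs_def)
qed

lemma linear_function_space_bdd_cont_funs: "linear_function_space (topspace X) (bdd_cont_funs X)"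
proof -
  have add: "bounded ((\<lambda>x\<in>topspace X. f x + g x) ` topspace X)"
    if fg: "bounded (f ` topspace X)" "bounded (g ` topspace X)" for f g :: "'a \<Rightarrow> real"
  proof -
    have "bounded ((\<lambda>x. f x + g x) ` topspace X)" using fg by (rule bounded_plus_comp)
    then show ?thesis by (simp cong: image_cong)
  qed
  have scale: "bounded ((\<lambda>x\<in>topspace X. a * f x) ` topspace X)"
    if f: "bounded (f ` topspace X)" for f :: "'a \<Rightarrow> real" and a
  proof -
    have "bounded ((\<lambda>t. a *\<^sub>R t) ` f ` topspace X)" using f by (rule bounded_scaling)
    then show ?thesis by (simp add: image_image cong: image_cong)
  qed
  show ?thesis
    using linear_function_space_cont_funs[of X] add scale
    by (auto simp: linear_function_space_def bdd_cont_funs_def)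
qed

lemma linear_functional_sum:
  fixes L :: "('a \<Rightarrow> real) \<Rightarrow> real"
  assumes D: "linear_function_space A D"
    and add: "\<And>f g. f \<in> D \<Longrightarrow> g \<in> D \<Longrightarrow> L (\<lambda>x\<in>A. f x + g x) = L f + L g"
    and scale: "\<And>a f. f \<in> D \<Longrightarrow> L (\<lambda>x\<in>A. a * f x) = a * L f"
    and zero: "(\<lambda>x\<in>A. 0) \<in> D"
    and "finite K" "\<And>k. k \<in> K \<Longrightarrow> h k \<in> D"
  shows "(\<lambda>x\<in>A. \<Sum>k\<in>K. a k * h k x) \<in> D \<and>
    L (\<lambda>x\<in>A. \<Sum>k\<in>K. a k * h k x) = (\<Sum>k\<in>K. a k * L (h k))"
  using assms(5,6)
proof (induction K rule: finite_induct)
  case empty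
  show ?case using zero scale[OF zero, of 0] by (simp del: restrict_apply cong: restrict_cong)
next
  case (insert k K)
  define S where "S = (\<lambda>x\<in>A. \<Sum>k\<in>K. a k * h k x)"
  have S: "S \<in> D" "L S = (\<Sum>k\<in>K. a k * L (h k))" unfolding S_def using insert.IH insert.prems by blast+
  define H where "H = (\<lambda>x\<in>A. a k * h k x)"
  have H: "H \<in> D" "L H = a k * L (h k)"
    unfolding H_def using insert.prems D scale by (simp_all add: linear_function_space_def)
  have eq: "(\<lambda>x\<in>A. \<Sum>k\<in>insert k K. a k * h k x) = (\<lambda>x\<in>A. H x + S x)"
    using insert.hyps by (auto simp: S_def H_def)
  have "(\<lambda>x\<in>A. H x + S x) \<in> D"
    using D H(1) S(1) unfolding linear_function_space_def by blast
  then show ?case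
    unfolding eq using add[OF H(1) S(1)] H(2) S(2) insert.hyps by (simp del: restrict_apply)
qed

text \<open>Continuity at zero involves only a finite set \<open>K\<close>; being bounded on the
  subspace of functions vanishing on \<open>K\<close>, the functional is zero there. So
  \<open>L f\<close> depends only on the values of \<open>f\<close> on \<open>K\<close> and can be
  computed on an interpolant.\<close>

lemma (in Metric_space) pointwise_continuous_functional_eq_finite_sum:
  fixes L :: "('a \<Rightarrow> real) \<Rightarrow> real"
  assumes D: "linear_function_space M D" and bdd: "bdd_cont_funs mtopology \<subseteq> D"
    and add: "\<And>f g. f \<in> D \<Longrightarrow> g \<in> D \<Longrightarrow> L (\<lambda>x\<in>M. f x + g x) = L f + L g"
    and scale: "\<And>a f. f \<in> D \<Longrightarrow> L (\<lambda>x\<in>M. a * f x) = a * L f"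
    and cont: "continuous_map (pointwise_topology mtopology D) euclideanreal L"
  obtains c where "finite {x. c x \<noteq> 0}" "{x. c x \<noteq> 0} \<subseteq> M"
    "\<And>f. f \<in> D \<Longrightarrow> L f = (\<Sum>x | c x \<noteq> 0. c x * f x)"
proof -
  define fz where "fz = (\<lambda>x\<in>M. 0::real)"
  have "continuous_map mtopology euclideanreal fz"
    by (rule continuous_map_eq[of _ _ "\<lambda>_. 0"]) (auto simp: fz_def)
  moreover have "bounded (fz ` M)" by (rule finite_imp_bounded, rule finite_subset[of _ "{0}"]) (auto simp: fz_def)
  moreover have "fz \<in> extensional M" by (simp add: fz_def)
  ultimately have fz: "fz \<in> D"
    using bdd by (auto simp: bdd_cont_funs_def cont_funs_def)
  have Lo: "L fz = 0" using scale[OF fz, of 0] by (simp add: fz_def del: restrict_apply cong: restrict_cong)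
  have ext: "D \<subseteq> extensional M"
    and add_mem: "\<And>f g. f \<in> D \<Longrightarrow> g \<in> D \<Longrightarrow> (\<lambda>x\<in>M. f x + g x) \<in> D"
    and scale_mem: "\<And>a f. f \<in> D \<Longrightarrow> (\<lambda>x\<in>M. a * f x) \<in> D"
    using D by (auto simp: linear_function_space_def)
  let ?PX = "product_topology (\<lambda>x. euclideanreal) M"
  have top: "topspace (pointwise_topology mtopology D) = D"
    using ext by (auto simp: pointwise_topology_def PiE_def)
  have "openin (pointwise_topology mtopology D) {f \<in> D. L f \<in> ball 0 1}"
    using openin_continuous_map_preimage[OF cont, of "ball 0 1"] top by simp
  then obtain W where W: "openin ?PX W" "W \<inter> D = {f \<in> D. L f \<in> ball 0 1}"
    by (auto simp: pointwise_topology_def openin_subtopology)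
  have "fz \<in> W \<inter> D" unfolding W(2) using fz Lo by simp
  then have fzW: "fz \<in> W" by blast
  then obtain U where U: "finite {x \<in> M. U x \<noteq> UNIV}" "fz \<in> Pi\<^sub>E M U" "Pi\<^sub>E M U \<subseteq> W"
    using W(1)[unfolded openin_product_topology_alt, rule_format, OF fzW] by auto
  define K where "K = {x \<in> M. U x \<noteq> UNIV}"
  have K: "finite K" "K \<subseteq> M" using U by (auto simp: K_def)
  have small: "\<bar>L f\<bar> < 1" if "f \<in> D" "\<And>x. x \<in> K \<Longrightarrow> f x = 0" for f
  proof -
    have "f x \<in> U x" if "x \<in> M" for x
      using U(2) \<open>\<And>x. x \<in> K \<Longrightarrow> f x = 0\<close> that by (cases "x \<in> K") (auto simp: K_def fz_def PiE_iff)
    then have "f \<in> Pi\<^sub>E M U" using ext that by (auto simp: PiE_iff)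
    then have "f \<in> W \<inter> D" using U(3) that by auto
    then show ?thesis unfolding W(2) by simp
  qed
  \<comment> \<open>Otherwise \<open>f\<close> divided by \<open>L f\<close> still vanishes on
    \<open>K\<close> but is sent to \<open>1\<close>, contradicting \<open>small\<close>.\<close>
  have vanish: "L f = 0" if f: "f \<in> D" "\<And>x. x \<in> K \<Longrightarrow> f x = 0" for f
  proof (rule ccontr)
    assume "L f \<noteq> 0"
    have "\<bar>L (\<lambda>x\<in>M. (1 / L f) * f x)\<bar> < 1"
      using f K by (intro small scale_mem) auto
    then have "\<bar>1 / L f * L f\<bar> < 1" unfolding scale[OF f(1)] .
    then show False using \<open>L f \<noteq> 0\<close> by simp
  qed
  \<comment> \<open>For such a radius the bumps centred in \<open>K\<close> are dual to the
    evaluations at \<open>K\<close>.\<close>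
  obtain r where r: "r > 0" "\<And>x z. x \<in> K \<Longrightarrow> z \<in> K \<Longrightarrow> z \<noteq> x \<Longrightarrow> r \<le> d x z"
    using finite_separated[OF K] by blast
  have h: "bump x r \<in> D" if "x \<in> K" for x
    using bump_in_bdd_cont_funs bdd that r K by blast
  define c where "c x = (if x \<in> K then L (bump x r) else 0)" for x
  have rep: "L f = (\<Sum>x\<in>K. c x * f x)" if f: "f \<in> D" for f
  proof -
    \<comment> \<open>The interpolant: it agrees with \<open>f\<close> on \<open>K\<close>, so the
      difference is annihilated by \<open>vanish\<close>.\<close>
    define S where "S = (\<lambda>z\<in>M. \<Sum>x\<in>K. f x * bump x r z)"
    have S: "S \<in> D" "L S = (\<Sum>x\<in>K. f x * L (bump x r))"
      using linear_functional_sum[of M D L K "\<lambda>x. bump x r" f] D add scale fz K(1) h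
      unfolding S_def fz_def by blast+
    have Sz: "S z = f z" if "z \<in> K" for z
    proof -
      have "(\<Sum>x\<in>K. f x * bump x r z) = (\<Sum>x\<in>K. if x = z then f z else 0)"
        using r that K by (intro sum.cong) (auto simp: bump_centre bump_eq_0 subset_iff)
      also have "\<dots> = f z" using that K(1) by simp
      finally show ?thesis using that K(2) unfolding S_def by (simp add: subset_iff)
    qed
    define S' where "S' = (\<lambda>x\<in>M. - 1 * S x)"
    have S': "S' \<in> D" "L S' = - 1 * L S"
      unfolding S'_def using S(1) by (rule scale_mem, rule scale)
    have "L (\<lambda>x\<in>M. f x + S' x) = 0"
    proof (rule vanish[OF add_mem[OF f S'(1)]])
      fix x assume "x \<in> K"
      then show "(\<lambda>x\<in>M. f x + S' x) x = 0" using Sz K(2) by (simp add: S'_def subset_iff)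
    qed
    then have "L f = L S" using add[OF f S'(1)] S'(2) by simp
    then show ?thesis using S(2) by (simp add: c_def mult.commute)
  qed
  show thesis
  proof
    have sub: "{x. c x \<noteq> 0} \<subseteq> K" by (auto simp: c_def)
    then show "finite {x. c x \<noteq> 0}" "{x. c x \<noteq> 0} \<subseteq> M" using K finite_subset by auto
    show "L f = (\<Sum>x | c x \<noteq> 0. c x * f x)" if "f \<in> D" for f
      unfolding rep[OF that] using sub K(1) by (intro sum.mono_neutral_right) auto
  qed
qed

section \<open>Lower semicontinuity of supports\<close>

lemma closedin_complementI:
  assumes "S \<subseteq> topspace Y"
    and "\<And>y. y \<in> topspace Y - S \<Longrightarrow> \<exists>V. openin Y V \<and> y \<in> V \<and> V \<inter> S = {}"
  shows "closedin Y S"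
  unfolding closedin_def
proof (intro conjI assms(1))
  show "openin Y (topspace Y - S)"
  proof (subst openin_subopen, intro ballI)
    fix y assume "y \<in> topspace Y - S"
    then obtain V where "openin Y V" "y \<in> V" "V \<inter> S = {}" using assms(2) by blast
    then show "\<exists>V. openin Y V \<and> y \<in> V \<and> V \<subseteq> topspace Y - S"
      using openin_subset by (intro exI[of _ V]) blast
  qed
qed

text \<open>Common ground for all four choices of function spaces: \<open>D\<close> lies between the
  bounded and all continuous functions, and only bounded functions on \<open>Y\<close> are required
  to be attained.\<close>

locale finite_support_representation = Metric_space M d for M :: "'a set" and d +
  fixes Y :: "'b topology" and D :: "('a \<Rightarrow> real) set"
    and T :: "('a \<Rightarrow> real) \<Rightarrow> 'b \<Rightarrow> real" and c :: "'b \<Rightarrow> 'a \<Rightarrow> real"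
  assumes T4: "T4_space Y"
    and bdd_cont_funs_subset: "bdd_cont_funs mtopology \<subseteq> D"
    and subset_cont_funs: "D \<subseteq> cont_funs mtopology"
    and continuous_T: "\<And>f. f \<in> D \<Longrightarrow> continuous_map Y euclideanreal (T f)"
    and finite_coeffs: "\<And>y. y \<in> topspace Y \<Longrightarrow> finite {x. c y x \<noteq> 0}"
    and coeffs_subset: "\<And>y. y \<in> topspace Y \<Longrightarrow> {x. c y x \<noteq> 0} \<subseteq> M"
    and T_eq_sum: "\<And>y f. y \<in> topspace Y \<Longrightarrow> f \<in> D \<Longrightarrow> T f y = (\<Sum>x | c y x \<noteq> 0. c y x * f x)"
    and onto_bdd: "\<And>g. g \<in> bdd_cont_funs Y \<Longrightarrow> \<exists>f\<in>D. T f = g"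
begin

definition supp :: "'b \<Rightarrow> 'a set" where
  "supp y = {x. c y x \<noteq> 0}"

lemma finite_supp: "y \<in> topspace Y \<Longrightarrow> finite (supp y)"
  and supp_subset: "y \<in> topspace Y \<Longrightarrow> supp y \<subseteq> M"
  and T_eq: "y \<in> topspace Y \<Longrightarrow> f \<in> D \<Longrightarrow> T f y = (\<Sum>x\<in>supp y. c y x * f x)"
  using finite_coeffs coeffs_subset T_eq_sum by (auto simp: supp_def)

text \<open>A tent at \<open>x\<close> so narrow that it vanishes at the other points of
  \<open>supp y\<close> picks out a single coefficient.\<close>

lemma isolating_function:
  assumes y: "y \<in> topspace Y" and x: "x \<in> supp y" and U: "openin mtopology U" "x \<in> U"
  obtains f where "f \<in> D" "\<And>z. z \<in> M \<Longrightarrow> f z \<in> {0..1}" "\<And>z. z \<in> M - U \<Longrightarrow> f z = 0" "T f y = c y x"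
proof -
  have xM: "x \<in> M" using supp_subset x y by blast
  obtain r where r: "r > 0" "\<And>z. z \<in> supp y \<Longrightarrow> z \<noteq> x \<Longrightarrow> r \<le> d x z"
    using finite_isolating_radius[OF finite_supp supp_subset xM] y by blast
  obtain s where s: "s > 0" "mball x s \<subseteq> U" using U by (auto simp: openin_mtopology)
  define t where "t = min r s"
  have t: "t > 0" using r s by (simp add: t_def)
  show thesis
  proof
    show D: "bump x t \<in> D" using bump_in_bdd_cont_funs xM t bdd_cont_funs_subset by blast
    show "bump x t z \<in> {0..1}" if "z \<in> M" for z using bump_range t that by blast
    show "bump x t z = 0" if "z \<in> M - U" for z
    proof (rule bump_eq_0[OF t])
      show "z \<in> M" using that by simp
      have "z \<notin> mball x s" using that s by blast
      then show "t \<le> d x z" using that xM by (simp add: t_def)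
    qed
    have "T (bump x t) y = (\<Sum>z\<in>supp y. c y z * bump x t z)" by (rule T_eq[OF y D])
    also have "\<dots> = (\<Sum>z\<in>supp y. if z = x then c y x else 0)"
    proof (rule sum.cong)
      fix z assume z: "z \<in> supp y"
      then have "z \<in> M" using supp_subset y by blast
      then show "c y z * bump x t z = (if z = x then c y x else 0)"
        using r(2)[OF z] t xM by (auto simp: bump_centre bump_eq_0 t_def)
    qed simp
    also have "\<dots> = c y x" using x finite_supp[OF y] by simp
    finally show "T (bump x t) y = c y x" .
  qed
qed

text \<open>Lower semicontinuity: an isolating function \<open>f\<close> vanishing outside
  \<open>U\<close> has \<open>T f y \<noteq> 0\<close>, this persists near \<open>y\<close>, and it
  forces the support to meet \<open>U\<close>.\<close>

lemma openin_supp_meets: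
  assumes U: "openin mtopology U"
  shows "openin Y {y \<in> topspace Y. supp y \<inter> U \<noteq> {}}"
proof (subst openin_subopen, intro ballI)
  fix y assume "y \<in> {y \<in> topspace Y. supp y \<inter> U \<noteq> {}}"
  then obtain x where y: "y \<in> topspace Y" and x: "x \<in> supp y" "x \<in> U" by blast
  obtain f where f: "f \<in> D" "\<And>z. z \<in> M - U \<Longrightarrow> f z = 0" "T f y = c y x"
    using isolating_function[OF y x(1) U x(2)] by metis
  let ?V = "{y \<in> topspace Y. T f y \<in> - {0}}"
  have "openin Y ?V"
    using openin_continuous_map_preimage[OF continuous_T[OF f(1)], of "- {0}"] by (simp add: open_Compl)
  moreover have "y \<in> ?V" using y x f(3) by (simp add: supp_def)
  moreover have "supp y' \<inter> U \<noteq> {}" if y': "y' \<in> ?V" for y'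
  proof
    assume disj: "supp y' \<inter> U = {}"
    have "c y' z * f z = 0" if "z \<in> supp y'" for z
      using that supp_subset[of y'] y' disj f(2)[of z] by auto
    then have "(\<Sum>z\<in>supp y'. c y' z * f z) = 0" by (rule sum.neutral[OF ballI])
    then have "T f y' = 0" using T_eq[of y' f] y' f(1) by simp
    then show False using y' by simp
  qed
  ultimately show "\<exists>V. openin Y V \<and> y \<in> V \<and> V \<subseteq> {y \<in> topspace Y. supp y \<inter> U \<noteq> {}}"
    by (intro exI[of _ ?V]) auto
qed

lemma supp_near:
  assumes y: "y \<in> topspace Y" and e: "e > 0"
  obtains V where "openin Y V" "y \<in> V" "\<And>y' x. y' \<in> V \<Longrightarrow> x \<in> supp y \<Longrightarrow> \<exists>z\<in>supp y'. d x z < e"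
proof -
  \<comment> \<open>Finiteness of \<open>supp y\<close> makes the intersection open; the factor
    \<open>topspace Y\<close> takes care of an empty support.\<close>
  define V where "V = topspace Y \<inter> (\<Inter>x\<in>supp y. {y' \<in> topspace Y. supp y' \<inter> mball x e \<noteq> {}})"
  have "openin Y V"
    unfolding V_def
  proof (cases "supp y = {}")
    case False
    then show "openin Y (topspace Y \<inter> (\<Inter>x\<in>supp y. {y' \<in> topspace Y. supp y' \<inter> mball x e \<noteq> {}}))"
      using finite_supp[OF y] by (intro openin_Int openin_Inter) (auto simp: openin_supp_meets)
  qed auto
  moreover have "y \<in> V"
    unfolding V_def using y e supp_subset[OF y] by auto
  moreover have "\<exists>z\<in>supp y'. d x z < e" if "y' \<in> V" "x \<in> supp y" for y' x
    using that by (auto simp: V_def)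
  ultimately show thesis using that by blast
qed

text \<open>Balls of radius \<open>r / 2\<close> around the points of an \<open>r\<close>-separated
  support are disjoint. Every nearby support meets each of them, so it has at least as many
  points.\<close>

lemma closedin_card_supp_le: "closedin Y {y \<in> topspace Y. card (supp y) \<le> n}"
proof (rule closedin_complementI)
  fix y assume "y \<in> topspace Y - {y \<in> topspace Y. card (supp y) \<le> n}"
  then have y: "y \<in> topspace Y" "n < card (supp y)" by auto
  obtain r where r: "r > 0" "\<And>x z. x \<in> supp y \<Longrightarrow> z \<in> supp y \<Longrightarrow> z \<noteq> x \<Longrightarrow> r \<le> d x z"
    using finite_separated[OF finite_supp supp_subset] y(1) by metis
  obtain V where V: "openin Y V" "y \<in> V"
      "\<And>y' x. y' \<in> V \<Longrightarrow> x \<in> supp y \<Longrightarrow> \<exists>z\<in>supp y'. d x z < r / 2"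
    using supp_near[OF y(1), of "r / 2"] r(1) by auto
  have "n < card (supp y')" if y': "y' \<in> V" for y'
  proof -
    have y'Y: "y' \<in> topspace Y" using y' V(1) openin_subset by blast
    obtain s where s: "\<And>x. x \<in> supp y \<Longrightarrow> s x \<in> supp y' \<and> d x (s x) < r / 2"
      using V(3)[OF y'] by metis
    have "inj_on s (supp y)"
    proof (rule inj_onI, rule ccontr)
      fix x z assume xz: "x \<in> supp y" "z \<in> supp y" "s x = s z" "x \<noteq> z"
      have "d x z \<le> d x (s x) + d z (s z)"
        using triangle[of x "s x" z] xz s supp_subset y y'Y by (simp add: commute subset_iff)
      then show False using s[OF xz(1)] s[OF xz(2)] r(2)[OF xz(1,2)] xz(4) by auto
    qed
    then have "card (supp y) \<le> card (supp y')"
      using s finite_supp[OF y'Y] by (intro card_inj_on_le) auto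
    then show ?thesis using y(2) by simp
  qed
  then show "\<exists>V. openin Y V \<and> y \<in> V \<and> V \<inter> {y \<in> topspace Y. card (supp y) \<le> n} = {}"
    using V by (intro exI[of _ V]) force
qed auto

lemma closedin_supp_subset:
  assumes "closedin mtopology F"
  shows "closedin Y {y \<in> topspace Y. supp y \<subseteq> F}"
proof -
  have "openin Y {y \<in> topspace Y. supp y \<inter> (M - F) \<noteq> {}}"
    using assms by (intro openin_supp_meets) (simp add: closedin_def)
  moreover have "topspace Y - {y \<in> topspace Y. supp y \<subseteq> F} = {y \<in> topspace Y. supp y \<inter> (M - F) \<noteq> {}}"
    using supp_subset by blast
  ultimately show ?thesis by (simp add: closedin_def)
qed

text \<open>Two support points closer than \<open>e\<close> are shadowed by two such points in every
  nearby support, so a violation is an open condition.\<close>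

lemma closedin_supp_separated:
  "closedin Y {y \<in> topspace Y. \<forall>x\<in>supp y. \<forall>z\<in>supp y. x \<noteq> z \<longrightarrow> e \<le> d x z}" (is "closedin Y ?S")
proof (rule closedin_complementI)
  fix y assume "y \<in> topspace Y - ?S"
  then obtain x z where y: "y \<in> topspace Y" and xz: "x \<in> supp y" "z \<in> supp y" "x \<noteq> z" "d x z < e"
    by fastforce
  have M: "x \<in> M" "z \<in> M" using xz supp_subset[OF y] by auto
  then have pos: "d x z > 0" using xz by simp
  \<comment> \<open>The first bound keeps the shadowing points distinct, the second keeps them less
    than \<open>e\<close> apart.\<close>
  define t where "t = min (d x z / 2) ((e - d x z) / 2)"
  have t: "t > 0" using pos xz by (simp add: t_def)
  obtain V where V: "openin Y V" "y \<in> V"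
      "\<And>y' x. y' \<in> V \<Longrightarrow> x \<in> supp y \<Longrightarrow> \<exists>z\<in>supp y'. d x z < t"
    using supp_near[OF y t] by metis
  have "y' \<notin> ?S" if y': "y' \<in> V" for y'
  proof
    assume S: "y' \<in> ?S"
    obtain x' z' where x'z': "x' \<in> supp y'" "d x x' < t" "z' \<in> supp y'" "d z z' < t"
      using V(3)[OF y'] xz by metis
    have M': "x' \<in> M" "z' \<in> M" using x'z' supp_subset[of y'] S by auto
    have "x' \<noteq> z'" using triangle[of x x' z] M M' x'z' by (auto simp: t_def commute)
    then have "e \<le> d x' z'" using S x'z' by blast
    moreover have "d x' z' \<le> d x x' + d x z + d z z'"
      using triangle[of x' x z'] triangle[of x z z'] M M' by (simp add: commute)
    ultimately show False using x'z' by (simp add: t_def)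
  qed
  then have "V \<inter> ?S = {}" unfolding disjoint_iff by (intro allI impI)
  then show "\<exists>V. openin Y V \<and> y \<in> V \<and> V \<inter> ?S = {}" using V(1,2) by (intro exI conjI)
qed auto

section \<open>Norms of the functionals and consequences of surjectivity\<close>

text \<open>A bound on the dual norm of \<open>f \<mapsto> T f y\<close> for the supremum norm.
  Stated through test functions rather than coefficients, it is visibly a closed condition on
  \<open>y\<close>.\<close>

definition norm_le :: "real \<Rightarrow> 'b set" where
  "norm_le m = {y \<in> topspace Y. \<forall>f\<in>D. (\<forall>x\<in>M. \<bar>f x\<bar> \<le> 1) \<longrightarrow> \<bar>T f y\<bar> \<le> m}"

lemma closedin_norm_le: "closedin Y (norm_le m)"
proof -
  have "closedin Y {y \<in> topspace Y. T f y \<in> {-m..m}}" if "f \<in> D" for f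
    using closedin_continuous_map_preimage[OF continuous_T[OF that], of "{-m..m}"] by simp
  \<comment> \<open>Functions outside the unit ball of \<open>D\<close> contribute
    \<open>topspace Y\<close>, so the family is indexed by all functions and is nonempty.\<close>
  then have "closedin Y (\<Inter>f. if f \<in> D \<and> (\<forall>x\<in>M. \<bar>f x\<bar> \<le> 1) then {y \<in> topspace Y. T f y \<in> {-m..m}}
      else topspace Y)"
    by (intro closedin_Inter) auto
  moreover have "(\<Inter>f. if f \<in> D \<and> (\<forall>x\<in>M. \<bar>f x\<bar> \<le> 1) then {y \<in> topspace Y. T f y \<in> {-m..m}}
      else topspace Y) = norm_le m" (is "(\<Inter>f. ?B f) = _")
  proof (intro set_eqI iffI)
    fix y assume "y \<in> (\<Inter>f. ?B f)"
    then have B: "y \<in> ?B f" for f by blast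
    have "y \<in> topspace Y" using B[of undefined] by (simp split: if_splits)
    moreover have "\<bar>T f y\<bar> \<le> m" if "f \<in> D" "\<forall>x\<in>M. \<bar>f x\<bar> \<le> 1" for f
      using B[of f] that by (simp add: abs_le_iff)
    ultimately show "y \<in> norm_le m" by (simp add: norm_le_def)
  next
    fix y assume "y \<in> norm_le m"
    then show "y \<in> (\<Inter>f. ?B f)" by (auto simp: norm_le_def abs_le_iff)
  qed
  ultimately show ?thesis by simp
qed

text \<open>Isolating functions take values in \<open>{0..1}\<close>, hence are admissible test
  functions for \<open>norm_le\<close>.\<close>

lemma abs_coeff_le_norm:
  assumes "y \<in> norm_le m" "x \<in> supp y"
  shows "\<bar>c y x\<bar> \<le> m"
proof -
  have y: "y \<in> topspace Y" using assms(1) by (simp add: norm_le_def)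
  then have xM: "x \<in> M" using supp_subset assms by blast
  have "openin mtopology M" by (metis openin_topspace topspace_mtopology)
  then obtain f where "f \<in> D" "\<And>z. z \<in> M \<Longrightarrow> f z \<in> {0..1}" "T f y = c y x"
    using isolating_function[OF y assms(2) _ xM] by metis
  then show ?thesis using assms(1) by (fastforce simp: norm_le_def)
qed

text \<open>Ensures that each point of \<open>Y\<close> lies in \<open>norm_le m\<close> for some
  natural \<open>m\<close>.\<close>

lemma norm_le_sum_coeffs:
  assumes "y \<in> topspace Y" "(\<Sum>x\<in>supp y. \<bar>c y x\<bar>) \<le> m"
  shows "y \<in> norm_le m"
proof -
  have "\<bar>T f y\<bar> \<le> m" if f: "f \<in> D" "\<forall>x\<in>M. \<bar>f x\<bar> \<le> 1" for f
  proof -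
    have "\<bar>T f y\<bar> \<le> (\<Sum>x\<in>supp y. \<bar>c y x * f x\<bar>)"
      unfolding T_eq[OF assms(1) f(1)] by (rule sum_abs)
    also have "\<dots> \<le> (\<Sum>x\<in>supp y. \<bar>c y x\<bar>)"
      using f supp_subset[OF assms(1)]
      by (intro sum_mono) (auto simp: abs_mult subset_iff intro!: mult_left_le)
    finally show ?thesis using assms(2) by simp
  qed
  then show ?thesis using assms(1) by (simp add: norm_le_def)
qed

text \<open>An empty support would mean a zero functional, but surjectivity provides
  \<open>f\<close> with \<open>T f y = 1\<close>. This keeps the exponents of the powers
  positive.\<close>

lemma supp_nonempty:
  assumes y: "y \<in> topspace Y"
  shows "supp y \<noteq> {}"
proof
  assume "supp y = {}"
  have "closedin Y {y}" using y T4 by (simp add: T4_space_def closedin_Hausdorff_singleton)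
  then obtain g where "g \<in> bdd_cont_funs Y" "g y = 1"
    using T4_space_bdd_Urysohn[OF T4, of "{}" "{y}"] by auto
  then obtain f where "f \<in> D" "T f y = 1" using onto_bdd by blast
  then show False using T_eq[OF y] \<open>supp y = {}\<close> by simp
qed

text \<open>The functionals \<open>f \<mapsto> T f y\<close> are linearly independent because \<open>T\<close> is
  onto, and those with support \<open>K\<close> live in a space of dimension \<open>card K\<close>.\<close>

lemma finite_same_supp: "finite {y \<in> topspace Y. supp y = K}"
proof (rule ccontr)
  assume inf: "infinite {y \<in> topspace Y. supp y = K}"
  \<comment> \<open>One point more than \<open>card K\<close>, which forces a linear relation among
    the coefficient vectors.\<close>
  then obtain F where F: "F \<subseteq> {y \<in> topspace Y. supp y = K}" "finite F" "card F = Suc (card K)"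
    using infinite_arbitrarily_large by metis
  have "{y \<in> topspace Y. supp y = K} \<noteq> {}" using inf by force
  then have K: "finite K" using finite_supp by auto
  have "\<exists>a. (\<exists>y\<in>F. a y \<noteq> 0) \<and> (\<forall>x\<in>K. (\<Sum>y\<in>F. a y * c y x) = 0)"
    using F by (intro ex_nontrivial_linear_relation K) auto
  then obtain a w where a: "w \<in> F" "a w \<noteq> 0" "\<And>x. x \<in> K \<Longrightarrow> (\<Sum>y\<in>F. a y * c y x) = 0" by blast
  have clo: "closedin Y S" if "S \<subseteq> F" for S
    using that F T4 by (intro closedin_Hausdorff_finite) (auto simp: T4_space_def intro: finite_subset)
  \<comment> \<open>A preimage of \<open>g\<close> under \<open>T\<close> turns the relation into
    \<open>a w = 0\<close>.\<close>
  obtain g where g: "g \<in> bdd_cont_funs Y" "\<And>z. z \<in> F - {w} \<Longrightarrow> g z = 0" "g w = 1"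
    using T4_space_bdd_Urysohn[OF T4 clo[of "F - {w}"] clo[of "{w}"]] a(1) by auto
  obtain f where f: "f \<in> D" "T f = g" using onto_bdd g(1) by blast
  have "(\<Sum>y\<in>F. a y * g y) = (\<Sum>y\<in>F. \<Sum>x\<in>K. f x * (a y * c y x))"
    using F(1) T_eq[OF _ f(1)] f(2)
    by (intro sum.cong) (auto simp: sum_distrib_left subset_iff mult_ac)
  also have "\<dots> = (\<Sum>x\<in>K. f x * (\<Sum>y\<in>F. a y * c y x))"
    by (subst sum.swap) (simp add: sum_distrib_left)
  also have "\<dots> = 0" using a(3) by simp
  finally have "(\<Sum>y\<in>F. a y * g y) = 0" .
  moreover have "(\<Sum>y\<in>F. a y * g y) = a w * g w + (\<Sum>y\<in>F - {w}. a y * g y)"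
    using F(2) a(1) by (simp add: sum.remove)
  moreover have "(\<Sum>y\<in>F - {w}. a y * g y) = 0" using g(2) by simp
  ultimately show False using a(2) g(3) by simp
qed

end

section \<open>Closed finite-to-one maps into powers of the metric space\<close>

context finite_support_representation
begin

text \<open>Once the points of \<open>supp y\<close> are told apart by a locally constant \<open>p\<close>, enumerating each
  set \<open>p ` supp y\<close> in an arbitrary fixed way yields a continuous enumeration of \<open>supp y\<close>.\<close>

lemma ex_closed_map_to_power:
  assumes A: "closedin Y A" and \<delta>: "\<delta> > 0"
    and card_supp: "\<And>y. y \<in> A \<Longrightarrow> card (supp y) = n"
    and bound: "\<And>y x. y \<in> A \<Longrightarrow> x \<in> supp y \<Longrightarrow> \<bar>c y x\<bar> \<le> m"
    and inj: "\<And>y. y \<in> A \<Longrightarrow> inj_on p (supp y)"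
    and p: "\<And>y y' x z. y \<in> A \<Longrightarrow> y' \<in> A \<Longrightarrow> x \<in> supp y \<Longrightarrow> z \<in> supp y' \<Longrightarrow> d x z < \<delta> \<Longrightarrow> p x = p z"
  obtains g where
    "continuous_map (subtopology Y A) (product_topology (\<lambda>_. mtopology) {..<n}) g"
    "closed_map (subtopology Y A) (product_topology (\<lambda>_. mtopology) {..<n}) g"
    "finite_fibers (subtopology Y A) (product_topology (\<lambda>_. mtopology) {..<n}) g"
proof -
  let ?X = "product_topology (\<lambda>_. mtopology) {..<n}"
  have AY: "y \<in> topspace Y" if "y \<in> A" for y
    using A closedin_subset that by blast
  have topA: "topspace (subtopology Y A) = A" using AY by auto
  \<comment> \<open>One enumeration for each label set: supports with the same labels are listed in
    the same order.\<close>
  have "\<exists>h. bij_betw h {..<n} Q" if "finite Q" "card Q = n" for Q :: "'c set"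
    using ex_bij_betw_nat_finite[OF that(1)] that(2) by (auto simp: lessThan_atLeast0)
  then obtain h where h: "\<And>Q :: 'c set. finite Q \<Longrightarrow> card Q = n \<Longrightarrow> bij_betw (h Q) {..<n} Q"
    by metis
  define g where "g y = (\<lambda>i\<in>{..<n}. inv_into (supp y) p (h (p ` supp y) i))" for y
  have Q: "finite (p ` supp y)" "card (p ` supp y) = n" "bij_betw (h (p ` supp y)) {..<n} (p ` supp y)"
    if "y \<in> A" for y
    using finite_supp[OF AY] card_supp card_image[OF inj] that h by auto
  have gp: "g y i \<in> supp y" "p (g y i) = h (p ` supp y) i" if "y \<in> A" "i < n" for y i
  proof -
    have "h (p ` supp y) i \<in> p ` supp y" using Q(3)[OF that(1)] that(2) by (auto dest: bij_betwE)
    then show "g y i \<in> supp y" "p (g y i) = h (p ` supp y) i"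
      using that by (auto simp: g_def inv_into_into f_inv_into_f)
  qed
  have bij: "bij_betw (g y) {..<n} (supp y)" if y: "y \<in> A" for y
  proof -
    have "bij_betw p (supp y) (p ` supp y)" using inj[OF y] by (rule inj_on_imp_bij_betw)
    then have "bij_betw (inv_into (supp y) p \<circ> h (p ` supp y)) {..<n} (supp y)"
      using Q(3)[OF y] by (blast intro: bij_betw_trans bij_betw_inv_into)
    then show ?thesis by (rule bij_betw_cong[THEN iffD1, rotated]) (simp add: g_def)
  qed
  have gM: "g y i \<in> M" if "y \<in> A" "i < n" for y i
    using gp(1)[OF that] supp_subset[OF AY] that by blast
  have cont: "continuous_map (subtopology Y A) ?X g"
    unfolding continuous_map_componentwise
  proof (intro conjI ballI)
    show "g ` topspace (subtopology Y A) \<subseteq> extensional {..<n}" by (auto simp: g_def)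
  next
    fix i assume i: "i \<in> {..<n}"
    show "continuous_map (subtopology Y A) mtopology (\<lambda>y. g y i)"
      unfolding continuous_map_to_metric
    proof (intro ballI allI impI)
      fix y e assume "y \<in> topspace (subtopology Y A)" and e: "(e::real) > 0"
      then have y: "y \<in> A" by simp
      \<comment> \<open>The bound \<open>e\<close> controls the distance to the nearby support
        point, \<open>\<delta>\<close> makes that point carry the same label.\<close>
      obtain V where V: "openin Y V" "y \<in> V"
          "\<And>y' x. y' \<in> V \<Longrightarrow> x \<in> supp y \<Longrightarrow> \<exists>z\<in>supp y'. d x z < min e \<delta>"
        using supp_near[OF AY[OF y], of "min e \<delta>"] e \<delta> by auto
      have "g y' i \<in> mball (g y i) e" if y': "y' \<in> A \<inter> V" for y'
      proof -
        have y'A: "y' \<in> A" using y' by blast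
        obtain s where s: "\<And>x. x \<in> supp y \<Longrightarrow> s x \<in> supp y' \<and> d x (s x) < min e \<delta>"
          using V(3)[of y'] y' by (metis IntE)
        have ps: "p (s x) = p x" if "x \<in> supp y" for x
          by (rule p[OF y y'A that, symmetric]) (use s[OF that] in auto)
        have "p x \<in> p ` supp y'" if "x \<in> supp y" for x
          using ps[OF that] s[OF that] by (auto intro!: image_eqI[of _ _ "s x"])
        then have "p ` supp y \<subseteq> p ` supp y'" by blast
        \<comment> \<open>Both label sets have \<open>n\<close> elements, so inclusion is equality
          and the same enumeration applies to both supports.\<close>
        then have eq: "p ` supp y = p ` supp y'"
          using Q[OF y] Q[OF y'A] by (intro card_subset_eq) auto
        let ?x = "g y i"
        have x: "?x \<in> supp y" using gp y i by simp
        have "p (g y' i) = p (s ?x)" using gp(2)[of y i] gp(2)[of y' i] y y'A i eq ps[OF x] by simp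
        then have "g y' i = s ?x"
          using inj[OF y'A] gp(1)[OF y'A] s[OF x] i by (auto dest: inj_onD)
        then show ?thesis using s[OF x] gM[OF y, of i] gM[OF y'A, of i] i by auto
      qed
      moreover have "openin (subtopology Y A) (A \<inter> V)" using V(1) by (auto simp: openin_subtopology)
      ultimately show "\<exists>U. openin (subtopology Y A) U \<and> y \<in> U \<and> (\<forall>y'\<in>U. g y' i \<in> mball (g y i) e)"
        using y V(2) by (intro exI[of _ "A \<inter> V"]) auto
    qed
  qed
  have closed: "closed_map (subtopology Y A) ?X g"
    unfolding closed_map_def
  proof (intro allI impI)
    fix C assume "closedin (subtopology Y A) C"
    then have C: "closedin Y C" "C \<subseteq> A"
      using closedin_closed_subtopology[OF A] by auto
    \<comment> \<open>A metric on the power allows the image of \<open>C\<close> to be tested for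
      closedness on sequences.\<close>
    have "metrizable_space ?X"
      by (auto simp: metrizable_space_product_topology metrizable_space_mtopology)
    then obtain M' d' where "Metric_space M' d'" and X: "?X = Metric_space.mtopology M' d'"
      by (auto simp: metrizable_space_def)
    interpret X: Metric_space M' d' by fact
    have "closedin X.mtopology (g ` C)"
      unfolding X.metric_closedin_iff_sequentially_closed
    proof (intro conjI allI impI)
      have "g ` A \<subseteq> topspace ?X" using continuous_map_image_subset_topspace[OF cont] topA by simp
      then show "g ` C \<subseteq> M'" using C(2) unfolding X by auto
    next
      fix \<sigma> w assume \<sigma>: "range \<sigma> \<subseteq> g ` C \<and> limitin X.mtopology \<sigma> w sequentially"
      then have "\<exists>y. y \<in> C \<and> \<sigma> k = g y" for k by blast
      then obtain y where y: "\<And>k. y k \<in> C" "\<And>k. \<sigma> k = g (y k)" by metis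
      have yA: "y k \<in> A" for k using y(1) C(2) by blast
      have "\<sigma> = (\<lambda>k. g (y k))" using y(2) by auto
      then have lim: "limitin ?X (\<lambda>k. g (y k)) w sequentially"
        using \<sigma> unfolding X by simp
      have "bounded (range (\<lambda>k. c (y k) (g (y k) i)))" if "i < n" for i
        using bound yA gp(1) that by (intro boundedI[of _ m]) auto
      then obtain r where r: "strict_mono r"
          "\<And>i. i < n \<Longrightarrow> convergent (\<lambda>k. c (y (r k)) (g (y (r k)) i))"
        using finitely_many_bounded_imp_convergent_subseq[of n "\<lambda>i k. c (y k) (g (y k) i)"] by blast
      have limr: "limitin ?X (\<lambda>k. g (y (r k))) w sequentially"
        using limitin_subsequence[OF r(1) lim] by (simp add: o_def)
      have conv: "convergent (\<lambda>k. G (y (r k)))" if G: "G \<in> bdd_cont_funs Y" for G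
      proof -
        \<comment> \<open>Possibly unbounded, but its continuity suffices: each coordinate of the
          supports converges in \<open>M\<close>.\<close>
        obtain f where f: "f \<in> D" "T f = G" using onto_bdd[OF G] by blast
        have "continuous_map mtopology euclideanreal f"
          using f(1) subset_cont_funs by (auto simp: cont_funs_def)
        then have "convergent (\<lambda>k. f (g (y (r k)) i))" if "i < n" for i
          using continuous_map_limit[of mtopology euclideanreal f "\<lambda>k. g (y (r k)) i" "w i" sequentially]
            limr that by (auto simp: limitin_componentwise convergent_def o_def)
        then have "convergent (\<lambda>k. \<Sum>i<n. c (y (r k)) (g (y (r k)) i) * f (g (y (r k)) i))"
          using r(2) by (intro convergent_sum convergent_mult) auto
        moreover have "G (y k) = (\<Sum>i<n. c (y k) (g (y k) i) * f (g (y k) i))" for k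
        proof -
          have "G (y k) = (\<Sum>x\<in>supp (y k). c (y k) x * f x)"
            using T_eq[OF AY[OF yA] f(1)] f(2) by simp
          also have "\<dots> = (\<Sum>i<n. c (y k) (g (y k) i) * f (g (y k) i))"
            by (rule sum.reindex_bij_betw[OF bij[OF yA], symmetric])
          finally show ?thesis .
        qed
        ultimately show ?thesis by simp
      qed
      have "range (\<lambda>k. y (r k)) \<subseteq> topspace Y" using AY yA by auto
      from convergent_test_functions_imp_cluster_point[OF T4 this conv]
      obtain z where z: "z \<in> topspace Y" "\<And>V. openin Y V \<Longrightarrow> z \<in> V \<Longrightarrow> infinite {k. y (r k) \<in> V}"
        by blast
      have zC: "z \<in> C"
      proof (rule ccontr)
        assume "z \<notin> C"
        then have "infinite {k. y (r k) \<in> topspace Y - C}"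
          using z C(1) by (intro z(2)) (auto simp: closedin_def)
        then show False using y(1) by simp
      qed
      then have zA: "z \<in> A" using C(2) by blast
      \<comment> \<open>Every neighbourhood of \<open>z\<close> contains infinitely many terms,
        while almost all terms are mapped near \<open>w\<close>; so \<open>g z\<close> and
        \<open>w\<close> cannot be separated.\<close>
      have "g z = w"
      proof (rule ccontr)
        assume "g z \<noteq> w"
        have "g z \<in> M'" using continuous_map_image_subset_topspace[OF cont] topA zA
          unfolding X by auto
        moreover have "w \<in> M'" using limr limitin_topspace unfolding X by fastforce
        ultimately obtain U U' where U: "openin ?X U" "openin ?X U'" "g z \<in> U" "w \<in> U'" "disjnt U U'"
          using X.Hausdorff_space_mtopology \<open>g z \<noteq> w\<close>
          unfolding X Hausdorff_space_def X.topspace_mtopology by metis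
        have "openin (subtopology Y A) {y \<in> A. g y \<in> U}"
          using openin_continuous_map_preimage[OF cont U(1)] unfolding topA .
        then obtain V where V: "openin Y V" "{y \<in> A. g y \<in> U} = V \<inter> A"
          by (auto simp: openin_subtopology)
        then have "infinite {k. y (r k) \<in> V}" using zA U(3) by (intro z(2)) auto
        moreover have "\<forall>\<^sub>F k in sequentially. g (y (r k)) \<in> U'"
          using limr U(2,4) by (simp add: limitin_def)
        then have "finite {k. g (y (r k)) \<notin> U'}"
          by (simp add: cofinite_eq_sequentially[symmetric] eventually_cofinite)
        moreover have "{k. y (r k) \<in> V} \<subseteq> {k. g (y (r k)) \<notin> U'}"
          using V(2) U(5) yA by (auto simp: disjnt_iff)
        ultimately show False using finite_subset by blast
      qed
      then show "w \<in> g ` C" using zC by blast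
    qed
    then show "closedin ?X (g ` C)" unfolding X .
  qed
  have "finite_fibers (subtopology Y A) ?X g"
    unfolding finite_fibers_def
  proof
    fix w
    \<comment> \<open>The tuple \<open>w\<close> lists the support, so all points of one fiber have
      the same support.\<close>
    have "supp z = w ` {..<n}" if "z \<in> A" "g z = w" for z
      using bij_betw_imp_surj_on[OF bij] that by metis
    then have "{z \<in> topspace (subtopology Y A). g z = w} \<subseteq> {y \<in> topspace Y. supp y = w ` {..<n}}"
      by auto
    then show "finite {z \<in> topspace (subtopology Y A). g z = w}"
      using finite_same_supp finite_subset by blast
  qed
  then show thesis using that cont closed by blast
qed

text \<open>Each piece is fixed by five natural numbers: support size \<open>n\<close>, member
  \<open>k\<close> of an \<open>F\<^sub>\<sigma>\<close> decomposition, norm bound \<open>m\<close>,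
  separation level \<open>i\<close>, and stage \<open>j\<close> of a partition. All the conditions
  are closed, and every point satisfies them for some choice.\<close>

lemma countable_cover_by_closed_preimages:
  assumes Y: "perfectly_normal_space Y"
  obtains \<F> where "countable \<F>" "\<F> \<noteq> {}" "\<Union>\<F> = topspace Y"
    "\<And>A. A \<in> \<F> \<Longrightarrow> closedin Y A \<and> (\<exists>n>0. \<exists>g.
       continuous_map (subtopology Y A) (product_topology (\<lambda>_. mtopology) {..<n::nat}) g \<and>
       closed_map (subtopology Y A) (product_topology (\<lambda>_. mtopology) {..<n}) g \<and>
       finite_fibers (subtopology Y A) (product_topology (\<lambda>_. mtopology) {..<n}) g)"
proof -
  \<comment> \<open>The shift by one reflects that supports are nonempty and yields positive
    exponents.\<close>
  define S where "S n = {y \<in> topspace Y. card (supp y) = Suc n}" for n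
  have "fsigma_in Y (S n)" for n
  proof -
    \<comment> \<open>Perfect normality makes the complement of this closed set
      \<open>F\<^sub>\<sigma>\<close>.\<close>
    have "gdelta_in Y {y \<in> topspace Y. card (supp y) \<le> n}"
      using Y closedin_card_supp_le by (auto simp: perfectly_normal_space_def)
    then have "fsigma_in Y (topspace Y - {y \<in> topspace Y. card (supp y) \<le> n})"
      by (simp add: gdelta_in_fsigma_in)
    moreover have "fsigma_in Y {y \<in> topspace Y. card (supp y) \<le> Suc n}"
      by (intro closed_imp_fsigma_in closedin_card_supp_le)
    ultimately have "fsigma_in Y ((topspace Y - {y \<in> topspace Y. card (supp y) \<le> n}) \<inter>
        {y \<in> topspace Y. card (supp y) \<le> Suc n})"
      by (rule fsigma_in_Int)
    also have "(topspace Y - {y \<in> topspace Y. card (supp y) \<le> n}) \<inter>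
        {y \<in> topspace Y. card (supp y) \<le> Suc n} = S n"
      by (auto simp: S_def)
    finally show ?thesis .
  qed
  then have "\<exists>C. (\<forall>k. closedin Y (C k)) \<and> (\<Union>k::nat. C k) = S n" for n
    unfolding fsigma_in_ascending by blast
  then obtain C where C: "\<And>n k. closedin Y (C n k)" "\<And>n. (\<Union>k::nat. C n k) = S n"
    by metis
  \<comment> \<open>The labels \<open>p i\<close> below agree only for points less than
    \<open>e i\<close> apart, hence are injective on \<open>e i\<close>-separated supports.\<close>
  define e where "e i = 1 / real (Suc i)" for i
  have "\<exists>(p :: 'a \<Rightarrow> 'a) X. (\<forall>j. closedin mtopology (X j)) \<and> M = (\<Union>j::nat. X j) \<and> incseq X \<and>
      (\<forall>j. \<forall>x\<in>X j. \<forall>z\<in>X j. d x z < 1 / Suc j \<longrightarrow> p x = p z) \<and>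
      (\<forall>x\<in>M. \<forall>z\<in>M. p x = p z \<longrightarrow> d x z < e i)" for i
  proof -
    have "e i > 0" by (simp add: e_def)
    from locally_constant_small_partition[OF this] show ?thesis by metis
  qed
  then obtain p :: "nat \<Rightarrow> 'a \<Rightarrow> 'a" and X where pX: "\<And>i j. closedin mtopology (X i j)"
      "\<And>i. M = (\<Union>j::nat. X i j)" "\<And>i. incseq (X i)"
      "\<And>i j x z. x \<in> X i j \<Longrightarrow> z \<in> X i j \<Longrightarrow> d x z < 1 / Suc j \<Longrightarrow> p i x = p i z"
      "\<And>i x z. x \<in> M \<Longrightarrow> z \<in> M \<Longrightarrow> p i x = p i z \<Longrightarrow> d x z < e i"
    by metis
  define A where "A = (\<lambda>(n, k, m, i, j). C n k \<inter> norm_le (real m) \<inter>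
      {y \<in> topspace Y. \<forall>x\<in>supp y. \<forall>z\<in>supp y. x \<noteq> z \<longrightarrow> e i \<le> d x z} \<inter>
      {y \<in> topspace Y. supp y \<subseteq> X i j})"
  have "y \<in> \<Union>(range A)" if y: "y \<in> topspace Y" for y
  proof -
    have "card (supp y) > 0" using finite_supp supp_nonempty y by (simp add: card_gt_0_iff)
    then obtain n where "card (supp y) = Suc n" using gr0_implies_Suc by blast
    then have "y \<in> (\<Union>k. C n k)" unfolding C(2) S_def using y by simp
    then obtain k where k: "y \<in> C n k" by blast
    obtain m :: nat where "(\<Sum>x\<in>supp y. \<bar>c y x\<bar>) \<le> real m" using real_arch_simple by blast
    then have m: "y \<in> norm_le (real m)" by (rule norm_le_sum_coeffs[OF y])
    obtain r where r: "r > 0" "\<And>x z. x \<in> supp y \<Longrightarrow> z \<in> supp y \<Longrightarrow> z \<noteq> x \<Longrightarrow> r \<le> d x z"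
      using finite_separated[OF finite_supp supp_subset] y by metis
    obtain i where "e i < r"
      using reals_Archimedean[OF r(1)] by (auto simp: e_def inverse_eq_divide)
    then have i: "\<forall>x\<in>supp y. \<forall>z\<in>supp y. x \<noteq> z \<longrightarrow> e i \<le> d x z" using r(2) by force
    have "\<exists>j. x \<in> X i j" if "x \<in> supp y" for x
      using that supp_subset[OF y] pX(2)[of i] by blast
    then obtain J where J: "\<And>x. x \<in> supp y \<Longrightarrow> x \<in> X i (J x)" by metis
    \<comment> \<open>A single stage contains the whole support, since the support is finite and the
      stages increase.\<close>
    have "x \<in> X i (Max (J ` supp y))" if "x \<in> supp y" for x
    proof -
      have "J x \<le> Max (J ` supp y)" using that finite_supp[OF y] by simp
      then show ?thesis using J[OF that] pX(3)[of i] by (auto simp: incseq_def)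
    qed
    then have "y \<in> A (n, k, m, i, Max (J ` supp y))"
      using k m i y by (auto simp: A_def)
    then show ?thesis by blast
  qed
  moreover have clo: "closedin Y (A t)" for t
    unfolding A_def
    by (cases t) (auto intro!: closedin_Int C(1) closedin_norm_le closedin_supp_separated
        closedin_supp_subset pX(1))
  ultimately have cover: "\<Union>(range A) = topspace Y" using closedin_subset by blast
  have map: "\<exists>n>0. \<exists>g.
       continuous_map (subtopology Y (A t)) (product_topology (\<lambda>_. mtopology) {..<n::nat}) g \<and>
       closed_map (subtopology Y (A t)) (product_topology (\<lambda>_. mtopology) {..<n}) g \<and>
       finite_fibers (subtopology Y (A t)) (product_topology (\<lambda>_. mtopology) {..<n}) g" for t
  proof -
    obtain n k m i j where t: "t = (n, k, m, i, j)" by (cases t) auto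
    have A: "y \<in> topspace Y" "y \<in> C n k" "y \<in> norm_le (real m)" "supp y \<subseteq> X i j"
        "\<And>x z. x \<in> supp y \<Longrightarrow> z \<in> supp y \<Longrightarrow> x \<noteq> z \<Longrightarrow> e i \<le> d x z" if "y \<in> A t" for y
      using that by (auto simp: A_def t)
    \<comment> \<open>The distance \<open>1 / Suc j\<close> serves as \<open>\<delta>\<close>:
      points of \<open>X i j\<close> closer than that have the same label.\<close>
    obtain g where
      "continuous_map (subtopology Y (A t)) (product_topology (\<lambda>_. mtopology) {..<Suc n}) g"
      "closed_map (subtopology Y (A t)) (product_topology (\<lambda>_. mtopology) {..<Suc n}) g"
      "finite_fibers (subtopology Y (A t)) (product_topology (\<lambda>_. mtopology) {..<Suc n}) g"
    proof (rule ex_closed_map_to_power[OF clo[of t], of "1 / Suc j" "Suc n" "real m" "p i"])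
      show "card (supp y) = Suc n" if "y \<in> A t" for y
      proof -
        have "y \<in> (\<Union>k. C n k)" using A(2)[OF that] by blast
        then show ?thesis unfolding C(2) S_def by simp
      qed
      show "\<bar>c y x\<bar> \<le> real m" if "y \<in> A t" "x \<in> supp y" for y x
        using abs_coeff_le_norm A(3) that by blast
      show "inj_on (p i) (supp y)" if "y \<in> A t" for y
      proof (rule inj_onI, rule ccontr)
        fix x z assume xz: "x \<in> supp y" "z \<in> supp y" "p i x = p i z" "x \<noteq> z"
        then have "d x z < e i" using pX(5) supp_subset[OF A(1)[OF that]] by blast
        then show False using A(5)[OF that xz(1,2,4)] by simp
      qed
      show "p i x = p i z"
        if "y \<in> A t" "y' \<in> A t" "x \<in> supp y" "z \<in> supp y'" "d x z < 1 / Suc j" for y y' x z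
        using pX(4) A(4)[OF that(1)] A(4)[OF that(2)] that(3-5) by blast
    qed auto
    then show ?thesis by blast
  qed
  show thesis
  proof
    show "countable (range A)" by simp
    show "range A \<noteq> {}" by simp
    show "\<Union>(range A) = topspace Y" by (rule cover)
    show "closedin Y B \<and> (\<exists>n>0. \<exists>g.
       continuous_map (subtopology Y B) (product_topology (\<lambda>_. mtopology) {..<n::nat}) g \<and>
       closed_map (subtopology Y B) (product_topology (\<lambda>_. mtopology) {..<n}) g \<and>
       finite_fibers (subtopology Y B) (product_topology (\<lambda>_. mtopology) {..<n}) g)"
      if "B \<in> range A" for B
      using that clo map by blast
  qed
qed

end

section \<open>Copies of powers on the carrier type and use of the closure conditions\<close>

text \<open>An infinite type is equipotent to its square, so tuples can be coded one coordinate at a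
  time. The codes place powers of a space on \<open>'u\<close>, where \<open>P\<close> is
  defined.\<close>

lemma ex_inj_on_tuples:
  assumes "infinite (UNIV :: 'u set)"
  shows "\<exists>e :: (nat \<Rightarrow> 'u) \<Rightarrow> 'u. inj_on e (extensional {..<n})"
proof (induction n)
  case 0
  show ?case by (auto simp: inj_on_def extensional_def fun_eq_iff)
next
  case (Suc n)
  then obtain e :: "(nat \<Rightarrow> 'u) \<Rightarrow> 'u" where e: "inj_on e (extensional {..<n})" by blast
  obtain q :: "'u \<times> 'u \<Rightarrow> 'u" where "bij_betw q (UNIV \<times> UNIV) UNIV"
    using card_of_Times_same_infinite[OF assms] unfolding card_of_ordIso[symmetric] by blast
  then have "inj q" using bij_betw_imp_inj_on by auto
  then have q: "q a = q b \<longleftrightarrow> a = b" for a b by (rule inj_eq)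
  let ?e = "\<lambda>f. q (e (restrict f {..<n}), f n)"
  have "inj_on ?e (extensional {..<Suc n})"
  proof (rule inj_onI)
    fix f f' :: "nat \<Rightarrow> 'u"
    assume f: "f \<in> extensional {..<Suc n}" "f' \<in> extensional {..<Suc n}" and eq: "?e f = ?e f'"
    then have "e (restrict f {..<n}) = e (restrict f' {..<n})" and n: "f n = f' n"
      by (simp_all add: q)
    then have r: "restrict f {..<n} = restrict f' {..<n}"
      using e by (auto dest: inj_onD)
    show "f = f'"
    proof (rule extensionalityI[OF f])
      fix i assume "i \<in> {..<Suc n}"
      then show "f i = f' i" using n fun_cong[OF r, of i] by (cases "i = n") (auto simp: less_Suc_eq)
    qed
  qed
  then show ?case by blast
qed

text \<open>Transport of structure: the topology is pulled back along the inverse of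
  \<open>e\<close>.\<close>

lemma homeomorphic_space_pullback_inv:
  assumes e: "inj_on e (topspace Z)"
  shows "Z homeomorphic_space pullback_topology (e ` topspace Z) (inv_into (topspace Z) e) Z"
    (is "_ homeomorphic_space ?W")
proof -
  let ?i = "inv_into (topspace Z) e"
  have "?i -` topspace Z \<inter> e ` topspace Z = e ` topspace Z" by (auto simp: inv_into_into)
  then have W: "topspace ?W = e ` topspace Z" by (simp add: topspace_pullback_topology)
  have "continuous_map Z Z (?i \<circ> e)"
    by (rule continuous_map_eq[OF continuous_map_id]) (simp add: e)
  then have "continuous_map Z ?W e" by (rule continuous_map_pullback') auto
  moreover have "continuous_map ?W Z (id \<circ> ?i)"
    by (rule continuous_map_pullback[OF continuous_map_id])
  ultimately have "homeomorphic_maps Z ?W e ?i"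
    using e W by (auto simp: homeomorphic_maps_def f_inv_into_f)
  then show ?thesis by (auto simp: homeomorphic_space_def)
qed

lemma countable_closed_cover_property:
  assumes "closed_under_countable_closed_unions P" "T4_space Z"
    and \<F>: "countable \<F>" "\<F> \<noteq> {}" "\<Union>\<F> = topspace Z"
    and P: "\<And>F. F \<in> \<F> \<Longrightarrow> closedin Z F \<and> P (subtopology Z F)"
  shows "P Z"
proof -
  have "topspace Z = (\<Union>n. from_nat_into \<F> n)"
    using \<F> by (simp add: range_from_nat_into)
  moreover have "closedin Z (from_nat_into \<F> n) \<and> P (subtopology Z (from_nat_into \<F> n))" for n
    using P from_nat_into[OF \<F>(2)] by blast
  ultimately show ?thesis
    using assms(1,2) unfolding closed_under_countable_closed_unions_def by blast
qed

text \<open>Condition (d) speaks of targets on \<open>'u\<close>, so the power is replaced by a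
  homeomorphic copy \<open>W\<close>, which has \<open>P\<close> by (b). Composing \<open>g\<close>
  with the homeomorphism preserves closedness and finite fibers.\<close>

lemma finite_to_one_closed_preimage_power:
  fixes X Z :: "'u topology" and g :: "'u \<Rightarrow> nat \<Rightarrow> 'u"
  assumes inf: "infinite (UNIV :: 'u set)"
    and prod: "closed_under_finite_products P"
    and pre: "closed_under_finite_to_one_closed_preimages P"
    and X: "metrizable_space X" "P X" and Z: "T4_space Z" and n: "n > 0"
    and g: "continuous_map Z (product_topology (\<lambda>_. X) {..<n}) g"
      "closed_map Z (product_topology (\<lambda>_. X) {..<n}) g"
      "finite_fibers Z (product_topology (\<lambda>_. X) {..<n}) g"
  shows "P Z"
proof -
  let ?X = "product_topology (\<lambda>_. X) {..<n}"
  obtain e :: "(nat \<Rightarrow> 'u) \<Rightarrow> 'u" where "inj_on e (extensional {..<n})"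
    using ex_inj_on_tuples[OF inf] by blast
  then have e: "inj_on e (topspace ?X)" by (rule inj_on_subset) (auto simp: PiE_def)
  then obtain W where W: "?X homeomorphic_space (W :: 'u topology)"
    using homeomorphic_space_pullback_inv by blast
  then obtain \<phi> where \<phi>: "homeomorphic_map ?X W \<phi>" by (auto simp: homeomorphic_space)
  have "metrizable_space ?X" using X(1) by (auto simp: metrizable_space_product_topology)
  then have mW: "metrizable_space W" using W homeomorphic_metrizable_space by blast
  then have "T4_space W"
    by (simp add: T4_space_def metrizable_imp_normal_space metrizable_imp_Hausdorff_space)
  moreover have "W homeomorphic_space ?X" using W homeomorphic_space_sym by blast
  moreover have "{..<n} \<noteq> {}" using n by auto
  ultimately have PW: "P W"
    using prod[unfolded closed_under_finite_products_def, rule_format, of "{..<n}" "\<lambda>_. X" W] X(2) by simp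
  have c: "continuous_map Z W (\<phi> \<circ> g)"
    using g(1) homeomorphic_imp_continuous_map[OF \<phi>] by (rule continuous_map_compose)
  have "closed_map Z W (\<phi> \<circ> g)"
    using g(2) homeomorphic_imp_closed_map[OF \<phi>] by (rule closed_map_compose)
  moreover have "finite_fibers Z W (\<phi> \<circ> g)"
    unfolding finite_fibers_def
  proof
    fix w assume "w \<in> topspace W"
    have inj: "inj_on \<phi> (topspace ?X)" using \<phi> homeomorphic_imp_injective_map by blast
    have gX: "g z \<in> topspace ?X" if "z \<in> topspace Z" for z
      using continuous_map_image_subset_topspace[OF g(1)] that by blast
    show "finite {z \<in> topspace Z. (\<phi> \<circ> g) z = w}"
    proof (cases "{z \<in> topspace Z. (\<phi> \<circ> g) z = w} = {}")
      case False
      then obtain z0 where z0: "z0 \<in> topspace Z" "\<phi> (g z0) = w" by auto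
      \<comment> \<open>By injectivity of \<open>\<phi>\<close>, the fiber over \<open>w\<close>
        lies in a single fiber of \<open>g\<close>.\<close>
      have "{z \<in> topspace Z. (\<phi> \<circ> g) z = w} \<subseteq> {z \<in> topspace Z. g z = g z0}"
        using z0 inj gX by (auto dest: inj_onD)
      moreover have "finite {z \<in> topspace Z. g z = g z0}"
        using g(3) gX[OF z0(1)] unfolding finite_fibers_def by blast
      ultimately show ?thesis using finite_subset by blast
    next
      case True
      then show ?thesis by (metis finite.emptyI)
    qed
  qed
  ultimately show ?thesis
    using pre[unfolded closed_under_finite_to_one_closed_preimages_def, rule_format, of Z W "\<phi> \<circ> g"]
      Z mW PW c by blast
qed

text \<open>A constant map from a finite space to a point of a metrizable space is closed with
  finite fibers, so (d) applies. This serves finite carrier types, which may have no room for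
  powers.\<close>

lemma finite_space_property:
  assumes pre: "closed_under_finite_to_one_closed_preimages P"
    and X: "metrizable_space X" "P X" and Z: "T4_space Z" "finite (topspace Z)"
    and ne: "topspace Z \<noteq> {} \<Longrightarrow> topspace X \<noteq> {}"
  shows "P Z"
proof -
  \<comment> \<open>If \<open>topspace X\<close> is empty then so is \<open>topspace Z\<close>, and
    the arbitrary value is never attained.\<close>
  define x where "x = (SOME x. x \<in> topspace X)"
  have x: "x \<in> topspace X" if "topspace Z \<noteq> {}"
    unfolding x_def using ne[OF that] by (simp add: some_in_eq)
  have "continuous_map Z X (\<lambda>_. x)"
    using x by (cases "topspace Z = {}") (auto simp: continuous_map_on_empty2)
  moreover have "closed_map Z X (\<lambda>_. x)"
    unfolding closed_map_def
  proof (intro allI impI)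
    fix C assume "closedin Z C"
    then have "C \<noteq> {} \<Longrightarrow> x \<in> topspace X" using x closedin_subset by blast
    then show "closedin X ((\<lambda>_. x) ` C)"
      using metrizable_imp_Hausdorff_space[OF X(1)]
      by (cases "C = {}") (auto simp: image_constant_conv closedin_Hausdorff_singleton)
  qed
  moreover have "finite_fibers Z X (\<lambda>_. x)"
    using Z(2) by (simp add: finite_fibers_def)
  ultimately show ?thesis
    using pre[unfolded closed_under_finite_to_one_closed_preimages_def, rule_format, of Z X "\<lambda>_. x"]
      X Z(1) by blast
qed

section \<open>From the representation of \<open>T\<close> to the property of
  \<open>Y\<close>\<close>

theorem theorem1p6:
  fixes X Y :: "'u topology"
    and DX DY :: "('u \<Rightarrow> real) set"
    and T :: "('u \<Rightarrow> real) \<Rightarrow> ('u \<Rightarrow> real)"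
    and P :: "'u topology \<Rightarrow> bool"
  assumes "metrizable_space X"
    and "perfectly_normal_space Y"
    and "DX = cont_funs X \<or> DX = bdd_cont_funs X"
    and "DY = cont_funs Y \<or> DY = bdd_cont_funs Y"
    and "linear_on_funs X DX Y T"
    and "continuous_map (pointwise_topology X DX) (pointwise_topology Y DY) T"
    and "T ` DX = DY"
    and "topological_property P"
    and "closed_hereditary P"
    and "closed_under_finite_products P"
    and "closed_under_countable_closed_unions P"
    and "closed_under_finite_to_one_closed_preimages P"
    and "P X"
  shows "P Y"
proof -
  obtain M d where "Metric_space M d" and X: "X = Metric_space.mtopology M d"
    using assms(1) by (auto simp: metrizable_space_def)
  interpret Metric_space M d by fact
  have T4: "T4_space Y" using assms(2) by (simp add: perfectly_normal_space_def)
  have sub: "bdd_cont_funs Z \<subseteq> cont_funs Z" for Z :: "'u topology"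
    by (auto simp: bdd_cont_funs_def)
  have DX: "linear_function_space M DX" "bdd_cont_funs mtopology \<subseteq> DX" "DX \<subseteq> cont_funs mtopology"
    using assms(3) sub linear_function_space_cont_funs[of mtopology]
      linear_function_space_bdd_cont_funs[of mtopology] unfolding X by auto
  have DY: "bdd_cont_funs Y \<subseteq> DY" "DY \<subseteq> cont_funs Y" using assms(4) sub by auto
  have add: "T (\<lambda>x\<in>M. f x + g x) y = T f y + T g y"
    if "f \<in> DX" "g \<in> DX" "y \<in> topspace Y" for f g y
    using assms(5) that by (simp add: linear_on_funs_def X)
  have scale: "T (\<lambda>x\<in>M. a * f x) y = a * T f y" if "f \<in> DX" "y \<in> topspace Y" for a f y
    using assms(5) that by (simp add: linear_on_funs_def X)
  define R where "R y c \<longleftrightarrow> finite {x. c x \<noteq> 0} \<and> {x. c x \<noteq> 0} \<subseteq> M \<and>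
      (\<forall>f\<in>DX. T f y = (\<Sum>x | c x \<noteq> 0. c x * f x))" for y c
  have "\<exists>c. R y c" if y: "y \<in> topspace Y" for y
  proof -
    \<comment> \<open>Evaluation at \<open>y\<close> is a coordinate projection; composed with
      \<open>T\<close> it is a pointwise continuous functional on \<open>DX\<close>.\<close>
    have "continuous_map (pointwise_topology Y DY) euclideanreal (\<lambda>g. g y)"
      unfolding pointwise_topology_def
      by (intro continuous_map_from_subtopology continuous_map_product_projection y)
    then have "continuous_map (pointwise_topology X DX) euclideanreal (\<lambda>f. T f y)"
      using continuous_map_compose[OF assms(6)] by (simp add: o_def)
    then obtain c where "finite {x. c x \<noteq> 0}" "{x. c x \<noteq> 0} \<subseteq> M"
        "\<And>f. f \<in> DX \<Longrightarrow> T f y = (\<Sum>x | c x \<noteq> 0. c x * f x)"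
      using pointwise_continuous_functional_eq_finite_sum[of DX "\<lambda>f. T f y"] DX(1,2) add scale y
      unfolding X by blast
    then show ?thesis by (auto simp: R_def)
  qed
  then obtain c where "\<And>y. y \<in> topspace Y \<Longrightarrow> R y (c y)" by metis
  then have c: "\<And>y. y \<in> topspace Y \<Longrightarrow> finite {x. c y x \<noteq> 0}"
      "\<And>y. y \<in> topspace Y \<Longrightarrow> {x. c y x \<noteq> 0} \<subseteq> M"
      "\<And>y f. y \<in> topspace Y \<Longrightarrow> f \<in> DX \<Longrightarrow> T f y = (\<Sum>x | c y x \<noteq> 0. c y x * f x)"
    by (auto simp: R_def)
  interpret finite_support_representation M d Y DX T c
  proof
    show "continuous_map Y euclideanreal (T f)" if "f \<in> DX" for f
      using that assms(7) DY(2) by (auto simp: cont_funs_def)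
    show "\<exists>f\<in>DX. T f = g" if "g \<in> bdd_cont_funs Y" for g
      using that assms(7) DY(1) by (metis imageE subsetD)
  qed (use T4 DX c in auto)
  show "P Y"
  \<comment> \<open>The coding of tuples requires an infinite \<open>'u\<close>; if
    \<open>'u\<close> is finite, so is \<open>Y\<close>.\<close>
  proof (cases "finite (UNIV :: 'u set)")
    case True
    \<comment> \<open>Any point of \<open>Y\<close> has a nonempty support, which lies in
      \<open>X\<close>.\<close>
    have "topspace X \<noteq> {}" if "topspace Y \<noteq> {}"
      using that supp_nonempty supp_subset unfolding X by fastforce
    moreover have "finite (topspace Y)" using True by (rule finite_subset[rotated]) simp
    ultimately show ?thesis using finite_space_property assms(1,12,13) T4 by metis
  next
    case False
    obtain \<F> where \<F>: "countable \<F>" "\<F> \<noteq> {}" "\<Union>\<F> = topspace Y"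
      "\<And>A. A \<in> \<F> \<Longrightarrow> closedin Y A \<and> (\<exists>n>0. \<exists>g.
         continuous_map (subtopology Y A) (product_topology (\<lambda>_. X) {..<n::nat}) g \<and>
         closed_map (subtopology Y A) (product_topology (\<lambda>_. X) {..<n}) g \<and>
         finite_fibers (subtopology Y A) (product_topology (\<lambda>_. X) {..<n}) g)"
      using countable_cover_by_closed_preimages[OF assms(2)] unfolding X by blast
    show ?thesis
    proof (rule countable_closed_cover_property[OF assms(11) T4 \<F>(1-3)], intro conjI)
      fix A assume A: "A \<in> \<F>"
      show clo: "closedin Y A" using \<F>(4)[OF A] by blast
      have "T4_space (subtopology Y A)"
        using T4 clo by (simp add: T4_space_def normal_space_closed_subtopology Hausdorff_space_subtopology)
      then show "P (subtopology Y A)"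
        using \<F>(4)[OF A] finite_to_one_closed_preimage_power[OF False assms(10,12,1,13)] by blast
    qed
  qed
qed

end
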